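(* Let $n\ge3$. There are infinitely many negative numbers $-h$ (with $h>0$) for each of which the flower type Delaunay hypersurface of constant mean curvature $-h$ induces an immersion of constant mean curvature $-h$ from $S^1\times S^{n-2}$ into $\mathbb S^n$ (i.e. the complete flower type $(-h)$-curve is a closed curve in $\mathbb S^2$).
   Context: $\mathbb S^n$ is the unit sphere of $\mathbb C\oplus\mathbb R^{n-1}$, $\mathbb S^2$ the unit sphere of $\mathbb C\oplus\mathbb R$, $S^{n-2}$ the unit sphere of $\mathbb R^{n-1}$, $p=(0,1)\in\mathbb S^2$. A curve $\gamma=(z,b)$ in $\mathbb S^2$ with $b>0$ generates the hypersurface $G_\gamma(t,x)=(z(t),b(t)x)$, $x\in S^{n-2}$, in $\mathbb S^n$. Mean curvature is unnormalized (trace of the second fundamental form), small geodesic spheres having positive mean curvature with respect to the normal pointing into the ball. Flower type $(-h)$-curve, $h>0$: put $L(s)=\cos s\,\sin^{n-2}s$ and $R(s)=\frac{h}{n-1}(1-\sin^{n-1}s)$. The set $\{s\in(0,\frac{\pi}{2}):R(s)<L(s)\}$ is an interval $(z_L,\frac{\pi}{2})$ with $z_L>0$. The local piece is $\gamma(s)=(\cos s\,e^{is_1(s)},\sin s)$, $s\in(z_L,\frac{\pi}{2})$, with $\frac{ds_1}{ds}=\frac{R}{\cos s\sqrt{L^2-R^2}}$; $s_1$ has finite limits at both ends. The complete curve is obtained by repeated continuation: at an endpoint with $s=z_L$ and limiting phase $\theta$, by the image under $(z,b)\mapsto(e^{2i\theta}\bar z,b)$; at $p$ (where $s\to\frac{\pi}{2}$)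 with limiting phase $\theta$, by the image under $(z,b)\mapsto(-e^{2i\theta}\bar z,b)$. It is an analytic curve whose generated hypersurface has constant mean curvature $-h$ with respect to the unit normal which along the local pieces points toward the great circle $\{b=0\}$ (positive inner product with $(\sin s\,e^{is_1},-\cos s\,x)$). *)

theory Defs
  imports "HOL-Analysis.Analysis"
begin

section \<open>Flower type curves in the two-sphere\<close>

text \<open>Points of the two-sphere are pairs \<open>(z, b)\<close> of a complex and a real number. Below \<open>n\<close> is
  the dimension of the ambient sphere; everything is meant for \<open>n \<ge> 3\<close> and \<open>h > 0\<close>.\<close>

definition flower_L :: "nat \<Rightarrow> real \<Rightarrow> real" where
  "flower_L n s = cos s * sin s ^ (n - 2)"

definition flower_R :: "nat \<Rightarrow> real \<Rightarrow> real \<Rightarrow> real" where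
  "flower_R n h s = h / (real n - 1) * (1 - sin s ^ (n - 1))"

text \<open>For \<open>h > 0\<close> and \<open>n \<ge> 3\<close> this set is the interval \<open>(z\<^sub>L, \<pi>/2)\<close>.\<close>

definition flower_dom :: "nat \<Rightarrow> real \<Rightarrow> real set" where
  "flower_dom n h = {s \<in> {0<..<pi/2}. flower_R n h s < flower_L n s}"

definition flower_zL :: "nat \<Rightarrow> real \<Rightarrow> real" where
  "flower_zL n h = Inf (flower_dom n h)"

text \<open>The initial phase is left free, so local pieces are determined up to a rotation of the
  complex factor.\<close>

definition flower_local_piece :: "nat \<Rightarrow> real \<Rightarrow> (real \<Rightarrow> complex \<times> real) \<Rightarrow> bool" where
  "flower_local_piece n h \<gamma> \<longleftrightarrow>
    (\<exists>s1. \<forall>s \<in> flower_dom n h.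
       (s1 has_real_derivative
          flower_R n h s / (cos s * sqrt ((flower_L n s)\<^sup>2 - (flower_R n h s)\<^sup>2))) (at s) \<and>
       \<gamma> s = (complex_of_real (cos s) * cis (s1 s), sin s))"

text \<open>The phase is read off from \<open>sgn z = z / \<bar>z\<bar>\<close>, so \<open>\<theta>\<close> is determined modulo \<open>2\<pi>\<close>; the
  reflections below depend only on \<open>cis (2 * \<theta>)\<close>.\<close>

definition limiting_phase :: "(real \<Rightarrow> complex \<times> real) \<Rightarrow> real filter \<Rightarrow> real \<Rightarrow> bool" where
  "limiting_phase \<gamma> A \<theta> \<longleftrightarrow> ((\<lambda>s. sgn (fst (\<gamma> s))) \<longlongrightarrow> cis \<theta>) A"

definition continuation_at_zL ::
  "nat \<Rightarrow> real \<Rightarrow> (real \<Rightarrow> complex \<times> real) \<Rightarrow> (real \<Rightarrow> complex \<times> real) \<Rightarrow> bool" where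
  "continuation_at_zL n h \<gamma> \<gamma>' \<longleftrightarrow>
    (\<exists>\<theta>. limiting_phase \<gamma> (at_right (flower_zL n h)) \<theta> \<and>
      (\<forall>s \<in> flower_dom n h. \<gamma>' s = (cis (2 * \<theta>) * cnj (fst (\<gamma> s)), snd (\<gamma> s))))"

definition continuation_at_p ::
  "nat \<Rightarrow> real \<Rightarrow> (real \<Rightarrow> complex \<times> real) \<Rightarrow> (real \<Rightarrow> complex \<times> real) \<Rightarrow> bool" where
  "continuation_at_p n h \<gamma> \<gamma>' \<longleftrightarrow>
    (\<exists>\<theta>. limiting_phase \<gamma> (at_left (pi/2)) \<theta> \<and>
      (\<forall>s \<in> flower_dom n h. \<gamma>' s = (- cis (2 * \<theta>) * cnj (fst (\<gamma> s)), snd (\<gamma> s))))"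

text \<open>The bi-infinite sequence of pieces. Piece \<open>k\<close> and piece \<open>k + 1\<close> meet at \<open>p\<close> for even \<open>k\<close> and
  at \<open>s = z\<^sub>L\<close> for odd \<open>k\<close>. Both continuations are involutions, so for negative indices
  this says equally that piece \<open>k\<close> is the continuation of piece \<open>k + 1\<close>.\<close>

definition flower_pieces :: "nat \<Rightarrow> real \<Rightarrow> (int \<Rightarrow> real \<Rightarrow> complex \<times> real) \<Rightarrow> bool" where
  "flower_pieces n h P \<longleftrightarrow>
    flower_local_piece n h (P 0) \<and>
    (\<forall>k. if even k then continuation_at_p n h (P k) (P (k + 1))
                   else continuation_at_zL n h (P k) (P (k + 1)))"

text \<open>\<open>c\<close> is a continuous parametrization of the complete curve over the whole real line: it runs
  monotonically through piece \<open>k\<close> during \<open>(t k, t (k + 1))\<close>, with \<open>s\<close> increasing for even \<open>k\<close> and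
  decreasing for odd \<open>k\<close>. The speed is left free because the parameter \<open>s\<close> itself is not
  regular at \<open>s = z\<^sub>L\<close>.\<close>

definition complete_flower_curve :: "nat \<Rightarrow> real \<Rightarrow> (real \<Rightarrow> complex \<times> real) \<Rightarrow> bool" where
  "complete_flower_curve n h c \<longleftrightarrow>
    continuous_on UNIV c \<and>
    (\<exists>P (t :: int \<Rightarrow> real).
      flower_pieces n h P \<and> strict_mono t \<and> (\<forall>\<tau>. \<exists>k. t k \<le> \<tau> \<and> \<tau> < t (k + 1)) \<and>
      (\<forall>k. \<exists>\<sigma>. \<sigma> ` {t k<..<t (k + 1)} = flower_dom n h \<and>
        (if even k then strict_mono_on {t k<..<t (k + 1)} \<sigma>
                   else strict_antimono_on {t k<..<t (k + 1)} \<sigma>) \<and>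
        (\<forall>\<tau> \<in> {t k<..<t (k + 1)}. c \<tau> = P k (\<sigma> \<tau>))))"

definition closed_curve :: "(real \<Rightarrow> complex \<times> real) \<Rightarrow> real \<Rightarrow> bool" where
  "closed_curve c T \<longleftrightarrow> T > 0 \<and> (\<forall>\<tau>. c (\<tau> + T) = c \<tau>)"

text \<open>With \<open>CARD('m) = n - 1\<close>, the vector space \<open>complex \<times> (real ^ 'm)\<close> contains the ambient
  \<open>n\<close>-sphere, and \<open>sphere 0 1 :: (real ^ 'm) set\<close> is the \<open>(n - 2)\<close>-sphere.\<close>

definition generated_hypersurface ::
  "(real \<Rightarrow> complex \<times> real) \<Rightarrow> real \<Rightarrow> real ^ 'm \<Rightarrow> complex \<times> (real ^ 'm)" where
  "generated_hypersurface c \<tau> x = (fst (c \<tau>), snd (c \<tau>) *\<^sub>R x)"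

definition induced_by :: "(real \<Rightarrow> complex \<times> real) \<Rightarrow> real \<Rightarrow>
    (complex \<times> (real ^ 'm) \<Rightarrow> complex \<times> (real ^ 'm)) \<Rightarrow> bool" where
  "induced_by c T F \<longleftrightarrow>
    (\<forall>\<tau>. \<forall>x \<in> sphere 0 1. F (cis (2 * pi * \<tau> / T), x) = generated_hypersurface c \<tau> x)"

text \<open>At a point \<open>(cos s e\<^sup>i\<^sup>\<phi>, sin s x)\<close> with \<open>0 < s < \<pi>/2\<close>, the second vector is
  \<open>(sin s e\<^sup>i\<^sup>\<phi>, - cos s x)\<close>, which points toward the great circle \<open>b = 0\<close>. It is undefined at
  \<open>p\<close>, where \<open>z = 0\<close>.\<close>

definition toward_great_circle :: "(real \<Rightarrow> complex \<times> real) \<Rightarrow> real \<Rightarrow>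
    (complex \<times> (real ^ 'm) \<Rightarrow> complex \<times> (real ^ 'm)) \<Rightarrow> bool" where
  "toward_great_circle c T N \<longleftrightarrow>
    (\<forall>\<tau>. fst (c \<tau>) \<noteq> 0 \<longrightarrow> (\<forall>x \<in> sphere 0 1.
       N (cis (2 * pi * \<tau> / T), x) \<bullet>
         (snd (c \<tau>) *\<^sub>R sgn (fst (c \<tau>)), - norm (fst (c \<tau>)) *\<^sub>R x) > 0))"


section \<open>Hypersurface immersions of a circle times a sphere\<close>

definition circle_sphere :: "(complex \<times> (real ^ 'm)) set" where
  "circle_sphere = sphere 0 1 \<times> sphere 0 1"

definition circle_sphere_tangent :: "complex \<times> (real ^ 'm) \<Rightarrow> (complex \<times> (real ^ 'm)) set" where
  "circle_sphere_tangent q = {(v, w). fst q \<bullet> v = 0 \<and> snd q \<bullet> w = 0}"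

primrec times_differentiable_on ::
  "nat \<Rightarrow> 'a::real_normed_vector set \<Rightarrow> ('a \<Rightarrow> 'b::real_normed_vector) \<Rightarrow> bool" where
  "times_differentiable_on 0 = (\<lambda>U f. continuous_on U f)"
| "times_differentiable_on (Suc k) = (\<lambda>U f.
     (\<forall>x \<in> U. f differentiable (at x)) \<and>
     (\<forall>v. times_differentiable_on k U (\<lambda>x. frechet_derivative f (at x) v)))"

text \<open>Smoothness of a map on a subset: local extendability to smooth maps on open sets.\<close>

definition smooth_map_on ::
  "'a::real_normed_vector set \<Rightarrow> ('a \<Rightarrow> 'b::real_normed_vector) \<Rightarrow> bool" where
  "smooth_map_on M f \<longleftrightarrow>
    (\<forall>q \<in> M. \<exists>U g. open U \<and> q \<in> U \<and> (\<forall>k. times_differentiable_on k U g) \<and>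
       (\<forall>y \<in> U \<inter> M. g y = f y))"

text \<open>A derivative \<open>D\<close> at \<open>q\<close> within \<open>circle_sphere\<close> is determined exactly on the tangent
  space, where it is the differential of the map; only its values there are used below.\<close>

definition immersion_into_sphere :: "(complex \<times> (real ^ 'm) \<Rightarrow> complex \<times> (real ^ 'm)) \<Rightarrow> bool" where
  "immersion_into_sphere F \<longleftrightarrow>
    smooth_map_on circle_sphere F \<and> F ` circle_sphere \<subseteq> sphere 0 1 \<and>
    (\<forall>q \<in> circle_sphere. \<exists>D. (F has_derivative D) (at q within circle_sphere) \<and>
       inj_on D (circle_sphere_tangent q))"

definition unit_normal_field :: "(complex \<times> (real ^ 'm) \<Rightarrow> complex \<times> (real ^ 'm)) \<Rightarrow>
    (complex \<times> (real ^ 'm) \<Rightarrow> complex \<times> (real ^ 'm)) \<Rightarrow> bool" where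
  "unit_normal_field F N \<longleftrightarrow>
    smooth_map_on circle_sphere N \<and>
    (\<forall>q \<in> circle_sphere. norm (N q) = 1 \<and> N q \<bullet> F q = 0 \<and>
       (\<exists>D. (F has_derivative D) (at q within circle_sphere) \<and>
          (\<forall>v \<in> circle_sphere_tangent q. N q \<bullet> D v = 0)))"

text \<open>The second fundamental form with respect to \<open>N\<close> is \<open>II(v, w) = - dN(v) \<bullet> dF(w)\<close>, which is
  positive for small geodesic spheres with \<open>N\<close> pointing into the ball. Its trace for the induced
  metric is the sum over an orthonormal basis \<open>B\<close> of the tangent space, whose dimension is
  \<open>1 + (CARD('m) - 1)\<close>; it does not depend on \<open>B\<close>.\<close>

definition has_mean_curvature_at :: "(complex \<times> (real ^ 'm) \<Rightarrow> complex \<times> (real ^ 'm)) \<Rightarrow>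
    (complex \<times> (real ^ 'm) \<Rightarrow> complex \<times> (real ^ 'm)) \<Rightarrow> real \<Rightarrow> complex \<times> (real ^ 'm) \<Rightarrow> bool" where
  "has_mean_curvature_at F N H q \<longleftrightarrow>
    (\<exists>D E B. (F has_derivative D) (at q within circle_sphere) \<and>
       (N has_derivative E) (at q within circle_sphere) \<and>
       B \<subseteq> circle_sphere_tangent q \<and> finite B \<and> card B = CARD('m) \<and>
       (\<forall>v \<in> B. \<forall>w \<in> B. D v \<bullet> D w = (if v = w then 1 else 0)) \<and>
       (\<Sum>v \<in> B. - (E v \<bullet> D v)) = H)"

definition cmc_immersion :: "(complex \<times> (real ^ 'm) \<Rightarrow> complex \<times> (real ^ 'm)) \<Rightarrow>
    (complex \<times> (real ^ 'm) \<Rightarrow> complex \<times> (real ^ 'm)) \<Rightarrow> real \<Rightarrow> bool" where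
  "cmc_immersion F N H \<longleftrightarrow>
    immersion_into_sphere F \<and> unit_normal_field F N \<and>
    (\<forall>q \<in> circle_sphere. has_mean_curvature_at F N H q)"

end

theory Submission
  imports Defs
begin

text \<open>The curve is written down in closed form. With unit speed, its height \<open>b\<close> satisfies
  \<open>b'\<^sup>2 = 1 - b\<^sup>2 - A\<^sup>2\<close>, where \<open>A = h (1 - b ^ m) / (m b ^ (m - 1))\<close>, \<open>m = n - 1\<close>, is the angular momentum.
  The right-hand side has exactly two zeros, both simple: \<open>1\<close> and the minimal height \<open>\<beta>\<close>. Therefore
  \<open>b = (1 + \<beta>) / 2 + (1 - \<beta>) / 2 * cos u\<close> is a regular parametrization, in which the speed, the derivative
  of the phase and the signed radius \<open>\<zeta> = sin (u / 2) sqrt ((1 - \<beta>) (1 + b))\<close> are smooth everywhere, also at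
  \<open>p\<close>; the reflections defining the continuations are the symmetries of the cosine about the multiples
  of \<open>\<pi>\<close>. The curve closes up if the phase gained over \<open>[0, 2\<pi>]\<close> is a rational multiple of \<open>2\<pi>\<close>. This
  gain is a continuous, positive function of \<open>\<beta> \<in> (0, 1)\<close> and tends to \<open>0\<close> with \<open>\<beta>\<close>, so it takes infinitely
  many such values, while \<open>h\<close> is strictly increasing in \<open>\<beta>\<close>.\<close>

text \<open>The formula for \<open>A\<close> is a first integral: the mean curvature equation makes
  \<open>b ^ (m - 1) * A + \<kappa> * b ^ m\<close>, with \<open>\<kappa> = h / m\<close>, constant
  along the curve, and the constant is \<open>\<kappa>\<close> because a curve through
  \<open>p\<close> has no angular momentum there. The parameter \<open>u\<close> is chosen so that
  the squared derivative of \<open>b\<close> is \<open>(1 - b) * (b - \<beta>)\<close>; division by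
  \<open>1 - b\<^sup>2 - A\<^sup>2\<close> then cancels both simple zeros and leaves a smooth
  positive function of \<open>b\<close> as squared speed. The family is indexed by
  \<open>\<beta>\<close> because \<open>h\<close> is explicit in \<open>\<beta>\<close>, whereas the
  minimal height is only implicit in \<open>h\<close>. The obstacle is the pole \<open>p\<close>,
  where polar coordinates degenerate. A radius that may be negative removes it, at the price of a
  sign change at every passage through \<open>p\<close>; closing therefore takes a multiple of
  \<open>4 * pi\<close> instead of \<open>2 * pi\<close>. That the phase gain tends to 0 rests on
  the bound \<open>m * \<beta> / b\<close> for the integrand, whose integral over a period is
  exactly \<open>2 * pi * m * sqrt \<beta>\<close>.\<close>

subsection \<open>Calculus of repeatedly differentiable maps\<close>

lemma times_differentiable_on_SucD:
  assumes "times_differentiable_on (Suc k) U f"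
  shows "times_differentiable_on k U f"
  using assms
proof (induction k arbitrary: f)
  case 0
  then show ?case
    by (auto intro!: differentiable_imp_continuous_on simp: differentiable_on_def
        differentiable_at_withinI)
next
  case (Suc k)
  then show ?case by (metis times_differentiable_on.simps(2))
qed

lemma times_differentiable_on_cong:
  assumes "open U" "\<And>x. x \<in> U \<Longrightarrow> f x = g x" "times_differentiable_on k U f"
  shows "times_differentiable_on k U g"
  using assms(2,3)
proof (induction k arbitrary: f g)
  case 0
  then show ?case by (auto cong: continuous_on_cong)
next
  case (Suc k)
  have D: "(f has_derivative D) (at x) \<longleftrightarrow> (g has_derivative D) (at x)" if "x \<in> U" for x D
    using Suc.prems(1) that assms(1)
    by (metis has_derivative_transform_within_open)
  have "g differentiable (at x)" if "x \<in> U" for x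
    using Suc.prems(2) D[OF that] that unfolding differentiable_def
    by (metis differentiable_def times_differentiable_on.simps(2))
  moreover have "frechet_derivative f (at x) = frechet_derivative g (at x)" if "x \<in> U" for x
    using D[OF that] by (simp add: frechet_derivative_def)
  moreover have "times_differentiable_on k U (\<lambda>x. frechet_derivative g (at x) v)" for v
    by (rule Suc.IH[where f = "\<lambda>x. frechet_derivative f (at x) v"])
       (use Suc.prems(2) calculation(2) in auto)
  ultimately show ?case by simp
qed

text \<open>Lets inductions work with explicit derivative formulas in place of
  \<open>frechet_derivative\<close>. The two agree only on \<open>U\<close>, and maps that agree on
  an open set have the same derivatives there.\<close>

lemma times_differentiable_on_SucI:
  assumes "open U" "\<And>x. x \<in> U \<Longrightarrow> (f has_derivative D x) (at x)"
    and "\<And>v. times_differentiable_on k U (\<lambda>x. D x v)"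
  shows "times_differentiable_on (Suc k) U f"
proof -
  have "frechet_derivative f (at x) = D x" if "x \<in> U" for x
    using assms(2)[OF that] by (simp add: frechet_derivative_at[symmetric])
  then have "times_differentiable_on k U (\<lambda>x. frechet_derivative f (at x) v)" for v
    by (intro times_differentiable_on_cong[OF assms(1) _ assms(3)[of v]]) simp
  then show ?thesis
    using assms(2) by (auto simp: differentiable_def)
qed

lemma times_differentiable_on_SucE:
  assumes "times_differentiable_on (Suc k) U f"
  obtains D where "\<And>x. x \<in> U \<Longrightarrow> (f has_derivative D x) (at x)"
    "\<And>v. times_differentiable_on k U (\<lambda>x. D x v)"
proof
  show "(f has_derivative frechet_derivative f (at x)) (at x)" if "x \<in> U" for x
    using assms that by (simp add: frechet_derivative_works)
  show "times_differentiable_on k U (\<lambda>x. frechet_derivative f (at x) v)" for v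
    using assms by simp
qed

lemma times_differentiable_on_const: "times_differentiable_on k U (\<lambda>x. c)"
  by (induction k arbitrary: c) auto

lemma times_differentiable_on_bounded_linear:
  assumes "bounded_linear L" "open U" "times_differentiable_on k U f"
  shows "times_differentiable_on k U (\<lambda>x. L (f x))"
  using assms(3)
proof (induction k arbitrary: f)
  case 0
  then show ?case using bounded_linear.continuous_on[OF assms(1)] by simp
next
  case (Suc k)
  obtain D where D: "\<And>x. x \<in> U \<Longrightarrow> (f has_derivative D x) (at x)"
    "\<And>v. times_differentiable_on k U (\<lambda>x. D x v)"
    using times_differentiable_on_SucE[OF Suc.prems] by blast
  show ?case
    by (rule times_differentiable_on_SucI[OF assms(2), where D = "\<lambda>x v. L (D x v)"])
       (auto intro!: bounded_linear.has_derivative[OF assms(1)] D Suc.IH)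
qed

lemma times_differentiable_on_id:
  assumes "open U"
  shows "times_differentiable_on k U (\<lambda>x. x)"
proof (cases k)
  case (Suc j)
  then show ?thesis
    using times_differentiable_on_SucI[OF assms, of "\<lambda>x. x" "\<lambda>_ v. v" j]
    by (simp add: times_differentiable_on_const del: times_differentiable_on.simps)
qed simp

lemma times_differentiable_on_add:
  assumes "open U" "times_differentiable_on k U f" "times_differentiable_on k U g"
  shows "times_differentiable_on k U (\<lambda>x. f x + g x)"
  using assms(2,3)
proof (induction k arbitrary: f g)
  case 0
  then show ?case by (auto intro: continuous_on_add)
next
  case (Suc k)
  obtain D where D: "\<And>x. x \<in> U \<Longrightarrow> (f has_derivative D x) (at x)"
    "\<And>v. times_differentiable_on k U (\<lambda>x. D x v)"
    using times_differentiable_on_SucE[OF Suc.prems(1)] by blast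
  obtain E where E: "\<And>x. x \<in> U \<Longrightarrow> (g has_derivative E x) (at x)"
    "\<And>v. times_differentiable_on k U (\<lambda>x. E x v)"
    using times_differentiable_on_SucE[OF Suc.prems(2)] by blast
  show ?case
    by (rule times_differentiable_on_SucI[OF assms(1), where D = "\<lambda>x v. D x v + E x v"])
       (auto intro!: derivative_intros D E Suc.IH)
qed

text \<open>The product rule pairs each derivative with an undifferentiated factor, so the induction
  step also uses \<open>f\<close> and \<open>g\<close> at one order less, which
  \<open>times_differentiable_on_SucD\<close> supplies.\<close>

lemma times_differentiable_on_bilinear:
  assumes "bounded_bilinear B" "open U"
    and "times_differentiable_on k U f" "times_differentiable_on k U g"
  shows "times_differentiable_on k U (\<lambda>x. B (f x) (g x))"
  using assms(3,4)
proof (induction k arbitrary: f g)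
  case 0
  then show ?case by (auto intro: bounded_bilinear.continuous_on[OF assms(1)])
next
  case (Suc k)
  obtain D where D: "\<And>x. x \<in> U \<Longrightarrow> (f has_derivative D x) (at x)"
    "\<And>v. times_differentiable_on k U (\<lambda>x. D x v)"
    using times_differentiable_on_SucE[OF Suc.prems(1)] by blast
  obtain E where E: "\<And>x. x \<in> U \<Longrightarrow> (g has_derivative E x) (at x)"
    "\<And>v. times_differentiable_on k U (\<lambda>x. E x v)"
    using times_differentiable_on_SucE[OF Suc.prems(2)] by blast
  show ?case
    by (rule times_differentiable_on_SucI[OF assms(2),
          where D = "\<lambda>x v. B (f x) (E x v) + B (D x v) (g x)"])
       (intro bounded_bilinear.FDERIV[OF assms(1)] times_differentiable_on_add[OF assms(2)]
          D E Suc.IH Suc.prems[THEN times_differentiable_on_SucD]; assumption)+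
qed

lemma times_differentiable_on_Pair:
  assumes "open U" "times_differentiable_on k U f" "times_differentiable_on k U g"
  shows "times_differentiable_on k U (\<lambda>x. (f x, g x))"
proof -
  have "times_differentiable_on k U (\<lambda>x. (f x, 0) + (0, g x))"
    by (intro times_differentiable_on_add assms
        times_differentiable_on_bounded_linear[where L = "\<lambda>y. (y, 0)"]
        times_differentiable_on_bounded_linear[where L = "\<lambda>y. (0, y)"]
        bounded_linear_Pair bounded_linear_ident bounded_linear_zero)
  then show ?thesis by simp
qed

text \<open>For a real inner map the derivative of the outer one is applied to a scalar, so by
  linearity it is \<open>D x v\<close> times the derivative in the fixed direction 1. This keeps
  directions constant, as the recursive notion of differentiability demands; in a general chain rule
  the direction would vary with the point.\<close>

lemma times_differentiable_on_compose_real: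
  fixes f :: "'a::real_normed_vector \<Rightarrow> real"
  assumes "open U" "times_differentiable_on k UNIV g" "times_differentiable_on k U f"
  shows "times_differentiable_on k U (\<lambda>x. g (f x))"
  using assms(2,3)
proof (induction k arbitrary: f g)
  case 0
  then show ?case by (auto intro: continuous_on_compose2)
next
  case (Suc k)
  obtain D where D: "\<And>x. x \<in> U \<Longrightarrow> (f has_derivative D x) (at x)"
    "\<And>v. times_differentiable_on k U (\<lambda>x. D x v)"
    using times_differentiable_on_SucE[OF Suc.prems(2)] by blast
  obtain E where "\<And>x. x \<in> UNIV \<Longrightarrow> (g has_derivative E x) (at x)"
    and E: "\<And>v. times_differentiable_on k UNIV (\<lambda>x. E x v)"
    using times_differentiable_on_SucE[OF Suc.prems(1)] by blast
  then have E': "(g has_derivative E x) (at x)" for x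
    by simp
  have sc: "E y (D x v) = D x v *\<^sub>R E y 1" for x y v
    using linear_cmul[OF has_derivative_linear[OF E'], of y "D x v" 1] by simp
  have "((\<lambda>x. g (f x)) has_derivative (\<lambda>v. D x v *\<^sub>R E (f x) 1)) (at x)" if "x \<in> U" for x
    using has_derivative_compose[OF D(1)[OF that] E'] by (simp add: sc)
  then show ?case
  proof (rule times_differentiable_on_SucI[OF assms(1)])
    have "times_differentiable_on k U (\<lambda>x. E (f x) 1)"
      by (rule Suc.IH[of "\<lambda>y. E y 1" f])
         (fact E, fact times_differentiable_on_SucD[OF Suc.prems(2)])
    then show "times_differentiable_on k U (\<lambda>x. D x v *\<^sub>R E (f x) 1)" for v
      by (rule times_differentiable_on_bilinear[OF bounded_bilinear_scaleR assms(1) D(2)])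
  qed
qed

text \<open>The derivative is a product of \<open>D x v\<close> with two copies of the inverse
  itself, so the induction hypothesis covers it. The square root below is handled in the same
  way.\<close>

lemma times_differentiable_on_inverse:
  fixes f :: "'a::real_normed_vector \<Rightarrow> 'b::real_normed_field"
  assumes "open U" "times_differentiable_on k U f" "\<And>x. x \<in> U \<Longrightarrow> f x \<noteq> 0"
  shows "times_differentiable_on k U (\<lambda>x. inverse (f x))"
  using assms(2)
proof (induction k)
  case 0
  then show ?case using assms(3) by (auto intro!: continuous_on_inverse)
next
  case (Suc k)
  obtain D where D: "\<And>x. x \<in> U \<Longrightarrow> (f has_derivative D x) (at x)"
    "\<And>v. times_differentiable_on k U (\<lambda>x. D x v)"
    using times_differentiable_on_SucE[OF Suc.prems(1)] by blast
  have IH: "times_differentiable_on k U (\<lambda>x. inverse (f x))"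
    by (rule Suc.IH) (rule times_differentiable_on_SucD, fact)
  show ?case
  proof (rule times_differentiable_on_SucI[OF assms(1)])
    show "((\<lambda>x. inverse (f x)) has_derivative (\<lambda>v. - (inverse (f x) * D x v * inverse (f x)))) (at x)"
      if "x \<in> U" for x
      by (rule Deriv.has_derivative_inverse[OF assms(3)[OF that] D(1)[OF that]])
    show "times_differentiable_on k U (\<lambda>x. - (inverse (f x) * D x v * inverse (f x)))" for v
      by (intro times_differentiable_on_bounded_linear[where L = uminus] bounded_linear_minus
          bounded_linear_ident times_differentiable_on_bilinear[where B = "(*)"]
          bounded_bilinear_mult assms(1) IH D(2))
  qed
qed

lemma times_differentiable_on_sqrt:
  fixes f :: "'a::real_normed_vector \<Rightarrow> real"
  assumes "open U" "times_differentiable_on k U f" "\<And>x. x \<in> U \<Longrightarrow> f x > 0"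
  shows "times_differentiable_on k U (\<lambda>x. sqrt (f x))"
  using assms(2)
proof (induction k)
  case 0
  then show ?case by (auto intro: continuous_on_real_sqrt)
next
  case (Suc k)
  obtain D where D: "\<And>x. x \<in> U \<Longrightarrow> (f has_derivative D x) (at x)"
    "\<And>v. times_differentiable_on k U (\<lambda>x. D x v)"
    using times_differentiable_on_SucE[OF Suc.prems(1)] by blast
  have IH: "times_differentiable_on k U (\<lambda>x. sqrt (f x))"
    by (rule Suc.IH) (rule times_differentiable_on_SucD, fact)
  have "((\<lambda>x. sqrt (f x)) has_derivative (\<lambda>v. inverse (sqrt (f x)) * (D x v * (1/2)))) (at x)"
    if "x \<in> U" for x
    using assms(3)[OF that]
    by (auto intro!: derivative_eq_intros D(1)[OF that] simp: field_simps)
  then show ?case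
  proof (rule times_differentiable_on_SucI[OF assms(1)])
    show "times_differentiable_on k U (\<lambda>x. inverse (sqrt (f x)) * (D x v * (1/2)))" for v
      using assms(3)
      by (intro times_differentiable_on_bilinear[where B = "(*)"] bounded_bilinear_mult assms(1)
          times_differentiable_on_inverse IH D(2) times_differentiable_on_const)
         (metis less_irrefl real_sqrt_eq_0_iff)
  qed
qed

section \<open>Closure properties of smooth maps\<close>

definition smooth_on :: "'a::real_normed_vector set \<Rightarrow> ('a \<Rightarrow> 'b::real_normed_vector) \<Rightarrow> bool" where
  "smooth_on U f \<longleftrightarrow> (\<forall>k. times_differentiable_on k U f)"

lemma smooth_on_const: "smooth_on U (\<lambda>x. c)"
  by (simp add: smooth_on_def times_differentiable_on_const)

lemma smooth_on_id: "open U \<Longrightarrow> smooth_on U (\<lambda>x. x)"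
  by (simp add: smooth_on_def times_differentiable_on_id)

lemma smooth_on_bounded_linear:
  "bounded_linear L \<Longrightarrow> open U \<Longrightarrow> smooth_on U f \<Longrightarrow> smooth_on U (\<lambda>x. L (f x))"
  by (simp add: smooth_on_def times_differentiable_on_bounded_linear)

lemma smooth_on_add:
  "open U \<Longrightarrow> smooth_on U f \<Longrightarrow> smooth_on U g \<Longrightarrow> smooth_on U (\<lambda>x. f x + g x)"
  by (simp add: smooth_on_def times_differentiable_on_add)

lemma smooth_on_minus:
  "open U \<Longrightarrow> smooth_on U f \<Longrightarrow> smooth_on U (\<lambda>x. - f x)"
  by (rule smooth_on_bounded_linear[where L = uminus])
     (auto intro: bounded_linear_minus bounded_linear_ident)

lemma smooth_on_diff:
  "open U \<Longrightarrow> smooth_on U f \<Longrightarrow> smooth_on U g \<Longrightarrow> smooth_on U (\<lambda>x. f x - g x)"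
  using smooth_on_add[of U f "\<lambda>x. - g x"] smooth_on_minus[of U g] by simp

lemma smooth_on_mult:
  fixes f g :: "'a::real_normed_vector \<Rightarrow> 'b::real_normed_algebra"
  shows "open U \<Longrightarrow> smooth_on U f \<Longrightarrow> smooth_on U g \<Longrightarrow> smooth_on U (\<lambda>x. f x * g x)"
  by (simp add: smooth_on_def times_differentiable_on_bilinear bounded_bilinear_mult)

lemma smooth_on_scaleR:
  "open U \<Longrightarrow> smooth_on U f \<Longrightarrow> smooth_on U g \<Longrightarrow> smooth_on U (\<lambda>x. f x *\<^sub>R g x)"
  by (simp add: smooth_on_def times_differentiable_on_bilinear bounded_bilinear_scaleR)

lemma smooth_on_power:
  fixes f :: "'a::real_normed_vector \<Rightarrow> 'b::real_normed_field"
  shows "open U \<Longrightarrow> smooth_on U f \<Longrightarrow> smooth_on U (\<lambda>x. f x ^ j)"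
  by (induction j) (auto intro: smooth_on_const smooth_on_mult)

lemma smooth_on_sum:
  "open U \<Longrightarrow> (\<And>i. i \<in> I \<Longrightarrow> smooth_on U (f i)) \<Longrightarrow> smooth_on U (\<lambda>x. \<Sum>i\<in>I. f i x)"
  by (induction I rule: infinite_finite_induct) (auto intro: smooth_on_const smooth_on_add)

lemma smooth_on_Pair:
  "open U \<Longrightarrow> smooth_on U f \<Longrightarrow> smooth_on U g \<Longrightarrow> smooth_on U (\<lambda>x. (f x, g x))"
  by (simp add: smooth_on_def times_differentiable_on_Pair)

lemma smooth_on_compose_real:
  fixes f :: "'a::real_normed_vector \<Rightarrow> real"
  shows "open U \<Longrightarrow> smooth_on UNIV g \<Longrightarrow> smooth_on U f \<Longrightarrow> smooth_on U (\<lambda>x. g (f x))"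
  by (simp add: smooth_on_def times_differentiable_on_compose_real)

lemma smooth_on_divide:
  fixes f :: "'a::real_normed_vector \<Rightarrow> 'b::real_normed_field"
  shows "open U \<Longrightarrow> smooth_on U f \<Longrightarrow> smooth_on U g \<Longrightarrow> (\<And>x. x \<in> U \<Longrightarrow> g x \<noteq> 0) \<Longrightarrow>
    smooth_on U (\<lambda>x. f x / g x)"
  unfolding divide_inverse
  by (intro smooth_on_mult) (auto simp: smooth_on_def times_differentiable_on_inverse)

lemma smooth_on_sqrt:
  fixes f :: "'a::real_normed_vector \<Rightarrow> real"
  shows "open U \<Longrightarrow> smooth_on U f \<Longrightarrow> (\<And>x. x \<in> U \<Longrightarrow> f x > 0) \<Longrightarrow> smooth_on U (\<lambda>x. sqrt (f x))"
  by (simp add: smooth_on_def times_differentiable_on_sqrt)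

lemma smooth_on_antiderivative:
  fixes f :: "real \<Rightarrow> 'b::real_normed_vector"
  assumes "smooth_on UNIV f'" "\<And>u. (f has_vector_derivative f' u) (at u)"
  shows "smooth_on UNIV f"
proof -
  have "times_differentiable_on (Suc k) UNIV f" for k
    using assms
    by (intro times_differentiable_on_SucI[where D = "\<lambda>u v. v *\<^sub>R f' u"]
         times_differentiable_on_bilinear[where B = "(*\<^sub>R)"] times_differentiable_on_const
         bounded_bilinear_scaleR)
       (auto simp: has_vector_derivative_def smooth_on_def)
  then show ?thesis
    unfolding smooth_on_def by (blast intro: times_differentiable_on_SucD)
qed

lemma smooth_on_cis_UNIV: "smooth_on UNIV cis"
proof -
  have D: "(cis has_derivative (\<lambda>v. v *\<^sub>R (\<i> * cis u))) (at u)" for u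
    by (auto intro!: derivative_eq_intros simp: scaleR_conv_of_real mult_ac)
  have "times_differentiable_on k UNIV cis" for k
  proof (induction k)
    case 0
    then show ?case by (auto intro!: continuous_intros)
  next
    case (Suc k)
    show ?case
      by (rule times_differentiable_on_SucI[where D = "\<lambda>u v. v *\<^sub>R (\<i> * cis u)"])
         (auto intro!: D times_differentiable_on_bilinear[where B = "(*)"] bounded_bilinear_mult
           times_differentiable_on_bilinear[where B = "(*\<^sub>R)"] bounded_bilinear_scaleR
           times_differentiable_on_const Suc)
  qed
  then show ?thesis by (simp add: smooth_on_def)
qed

lemma smooth_on_cos_sin_UNIV: "smooth_on UNIV (cos :: real \<Rightarrow> real)" "smooth_on UNIV (sin :: real \<Rightarrow> real)"
  using smooth_on_bounded_linear[OF bounded_linear_Re _ smooth_on_cis_UNIV]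
    smooth_on_bounded_linear[OF bounded_linear_Im _ smooth_on_cis_UNIV] by simp_all

lemmas smooth_on_cis = smooth_on_compose_real[OF _ smooth_on_cis_UNIV]
lemmas smooth_on_cos = smooth_on_compose_real[OF _ smooth_on_cos_sin_UNIV(1)]
lemmas smooth_on_sin = smooth_on_compose_real[OF _ smooth_on_cos_sin_UNIV(2)]

lemmas smooth_on_intros = smooth_on_const smooth_on_id smooth_on_add smooth_on_minus smooth_on_diff
  smooth_on_mult smooth_on_scaleR smooth_on_power smooth_on_sum smooth_on_Pair smooth_on_divide
  smooth_on_sqrt smooth_on_cis smooth_on_cos smooth_on_sin

text \<open>Provides a continuous derivative, so that an identity between derivatives which holds
  off a discrete set extends by continuity.\<close>

lemma smooth_on_vector_derivative:
  fixes f :: "real \<Rightarrow> 'b::real_normed_vector"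
  assumes "smooth_on UNIV f"
  obtains f' where "\<And>u. (f has_vector_derivative f' u) (at u)" "smooth_on UNIV f'"
proof
  have T: "times_differentiable_on (Suc k) UNIV f" for k
    using assms by (simp add: smooth_on_def del: times_differentiable_on.simps)
  then have "f differentiable (at u)" for u
    by (meson UNIV_I times_differentiable_on.simps(2))
  then have D: "(f has_derivative frechet_derivative f (at u)) (at u)" for u
    by (simp add: frechet_derivative_works)
  show "(f has_vector_derivative frechet_derivative f (at u) 1) (at u)" for u
  proof -
    have "frechet_derivative f (at u) v = v *\<^sub>R frechet_derivative f (at u) 1" for v
      using linear_cmul[OF has_derivative_linear[OF D[of u]], of v 1] by simp
    then have "frechet_derivative f (at u) = (\<lambda>v. v *\<^sub>R frechet_derivative f (at u) 1)"
      by blast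
    then show ?thesis
      using D[of u] by (simp add: has_vector_derivative_def)
  qed
  show "smooth_on UNIV (\<lambda>u. frechet_derivative f (at u) 1)"
    using T by (auto simp: smooth_on_def)
qed

lemma smooth_on_continuous: "smooth_on U f \<Longrightarrow> continuous_on U f"
  unfolding smooth_on_def by (metis times_differentiable_on.simps(1))

lemma smooth_on_deriv:
  assumes "smooth_on UNIV (f :: real \<Rightarrow> real)"
  shows "(f has_real_derivative deriv f u) (at u)"
proof -
  obtain f' where "\<And>u. (f has_vector_derivative f' u) (at u)"
    using smooth_on_vector_derivative[OF assms] by blast
  then have "(f has_real_derivative f' u) (at u)"
    by (simp add: has_real_derivative_iff_has_vector_derivative)
  then show ?thesis by (metis DERIV_imp_deriv)
qed

text \<open>The derivative of a branch of the angle is \<open>Im (v / w)\<close>, from which both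
  the branch and the factor \<open>a\<close> have disappeared; it is smooth as a quotient.\<close>

lemma smooth_on_Im_Ln:
  assumes "a \<noteq> 0" "open U" "\<And>w. w \<in> U \<Longrightarrow> a * w \<notin> \<real>\<^sub>\<le>\<^sub>0"
  shows "smooth_on U (\<lambda>w. Im (Ln (a * w)))"
proof -
  have nz: "w \<noteq> 0" if "w \<in> U" for w using assms(3)[OF that] by auto
  have D: "((\<lambda>w. Im (Ln (a * w))) has_derivative (\<lambda>v. Im (v / w))) (at w)" if "w \<in> U" for w
  proof -
    have "((\<lambda>w. Ln (a * w)) has_field_derivative (1 / w)) (at w)"
      using assms(3)[OF that] assms(1) nz[OF that]
      by (auto intro!: derivative_eq_intros simp: field_simps)
    then have "((\<lambda>w. Ln (a * w)) has_derivative (\<lambda>v. v / w)) (at w)"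
      by (auto simp: has_field_derivative_def elim!: has_derivative_eq_rhs)
    then show ?thesis by (auto intro!: derivative_eq_intros)
  qed
  have S: "smooth_on U (\<lambda>w. Im (v / w))" for v
    using nz assms(2)
    by (intro smooth_on_bounded_linear[OF bounded_linear_Im] smooth_on_intros) auto
  have "times_differentiable_on (Suc k) U (\<lambda>w. Im (Ln (a * w)))" for k
    by (rule times_differentiable_on_SucI[OF assms(2) D])
       (use S in \<open>auto simp: smooth_on_def\<close>)
  then show ?thesis
    unfolding smooth_on_def by (blast intro: times_differentiable_on_SucD)
qed

subsection \<open>Immersions generated by closed curves\<close>

text \<open>The projection is linear, so a fixed direction \<open>v\<close> becomes the fixed
  direction \<open>fst v\<close> and the induction goes through for maps on any normed
  space.\<close>

lemma times_differentiable_on_compose_fst: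
  fixes f :: "'a::real_normed_vector \<Rightarrow> 'b::real_normed_vector"
  assumes "open U" "times_differentiable_on k U f"
  shows "times_differentiable_on k (U \<times> (UNIV :: 'c::real_normed_vector set)) (\<lambda>q. f (fst q))"
  using assms(2)
proof (induction k arbitrary: f)
  case 0
  then show ?case by (auto intro!: continuous_on_compose2[OF _ continuous_on_fst])
next
  case (Suc k)
  obtain D where D: "\<And>x. x \<in> U \<Longrightarrow> (f has_derivative D x) (at x)"
    "\<And>v. times_differentiable_on k U (\<lambda>x. D x v)"
    using times_differentiable_on_SucE[OF Suc.prems] by blast
  show ?case
  proof (rule times_differentiable_on_SucI[where D = "\<lambda>q v. D (fst q) (fst v)"])
    show "open (U \<times> (UNIV :: 'c set))" using assms(1) by (simp add: open_Times)
    show "((\<lambda>q. f (fst q)) has_derivative (\<lambda>v. D (fst q) (fst v))) (at q)"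
      if "q \<in> U \<times> UNIV" for q :: "'a \<times> 'c"
    proof (rule has_derivative_compose[where f = fst and g = f and f' = fst])
      show "(fst has_derivative fst) (at q)"
        by (auto intro!: derivative_eq_intros)
      show "(f has_derivative D (fst q)) (at (fst q))" using that by (auto intro: D(1))
    qed
    show "times_differentiable_on k (U \<times> (UNIV :: 'c set)) (\<lambda>q. D (fst q) (fst v))"
      for v :: "'a \<times> 'c"
      using Suc.IH[OF D(2)[of "fst v"]] by simp
  qed
qed

lemma smooth_on_compose_fst:
  "open U \<Longrightarrow> smooth_on U f \<Longrightarrow> smooth_on (U \<times> UNIV) (\<lambda>q. f (fst q))"
  by (simp add: smooth_on_def times_differentiable_on_compose_fst)

section \<open>Periodic functions and local angles on the circle\<close>

lemma periodic_of_int: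
  fixes f :: "real \<Rightarrow> 'a" and k :: int
  assumes "\<And>u. f (u + T) = f u"
  shows "f (u + of_int k * T) = f u"
proof (induction k rule: int_induct[where k = 0])
  case (step1 i)
  then show ?case using assms[of "u + of_int i * T"] by (simp add: algebra_simps)
next
  case (step2 i)
  then show ?case using assms[of "u + of_int (i - 1) * T"] by (simp add: algebra_simps)
qed simp

lemma sin_cos_int_pi:
  fixes x :: real and j :: int
  shows
  "sin (of_int j * pi + x) = (if even j then sin x else - sin x)"
  "cos (of_int j * pi + x) = (if even j then cos x else - cos x)"
proof -
  have "sin (of_int j * pi + x) = (if even j then sin x else - sin x) \<and>
    cos (of_int j * pi + x) = (if even j then cos x else - cos x)"
  proof (cases "even j")
    case True
    then obtain i where "j = 2 * i" by blast
    then have *: "of_int j * pi + x = x + of_int i * (2 * pi)" by simp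
    show ?thesis unfolding * periodic_of_int[of sin "2 * pi", simplified]
      periodic_of_int[of cos "2 * pi", simplified] using True by simp
  next
    case False
    then obtain i where "j = 2 * i + 1" using oddE by blast
    then have *: "of_int j * pi + x = (x + pi) + of_int i * (2 * pi)" by (simp add: algebra_simps)
    have "sin ((x + pi) + of_int i * (2 * pi)) = sin (x + pi)"
      "cos ((x + pi) + of_int i * (2 * pi)) = cos (x + pi)"
      by (rule periodic_of_int; simp)+
    then show ?thesis unfolding * using False by simp
  qed
  then show "sin (of_int j * pi + x) = (if even j then sin x else - sin x)"
    "cos (of_int j * pi + x) = (if even j then cos x else - cos x)" by auto
qed

lemma inner_mult_cis: "(c * cis t) \<bullet> (d * cis t) = c \<bullet> d"
proof -
  have i: "x \<bullet> y = Re (x * cnj y)" for x y :: complex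
    by (simp add: inner_complex_def)
  have "cis t * cnj (cis t) = 1" by (simp add: cis_cnj cis_mult)
  then have "c * cis t * cnj (d * cis t) = c * cnj d"
    by (metis complex_cnj_mult mult.assoc mult.commute mult_1)
  then show ?thesis unfolding i by (rule arg_cong)
qed

lemma periodic_cis_eq:
  fixes f :: "real \<Rightarrow> 'a"
  assumes "T > 0" "\<And>u. f (u + T) = f u" "cis (2 * pi * s / T) = cis (2 * pi * t / T)"
  shows "f s = f t"
proof -
  have "exp (\<i> * of_real (2 * pi * s / T)) = exp (\<i> * of_real (2 * pi * t / T))"
    using assms(3) by (simp add: cis_conv_exp)
  then obtain k :: int where
    "\<i> * of_real (2 * pi * s / T) = \<i> * of_real (2 * pi * t / T) + of_real (of_int (2 * k) * pi) * \<i>"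
    unfolding exp_eq by blast
  then have "2 * pi * s / T = 2 * pi * t / T + 2 * of_int k * pi"
    by (simp add: complex_eq_iff)
  also have "\<dots> = 2 * pi * (t + of_int k * T) / T"
    using assms(1) by (simp add: distrib_left add_divide_distrib)
  finally have "s = t + of_int k * T"
    using assms(1) by simp
  then show ?thesis by (simp add: periodic_of_int[of f, OF assms(2)])
qed

text \<open>A local inverse of the covering \<open>u \<mapsto> cis (2 * pi * u / T)\<close> through
  a prescribed parameter. Multiplication by \<open>cnj w\<close> rotates \<open>w\<close> to 1 and a
  half plane around it into the domain of the principal logarithm. The angle lives on an open subset
  of the plane, not just on the circle, because smoothness on \<open>circle_sphere\<close> means
  extendability.\<close>

lemma local_angle:
  assumes "T > 0" "cis (2 * pi * u / T) = w"
  obtains U \<theta> where "open U" "w \<in> U" "smooth_on U \<theta>" "\<theta> w = u"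
    "\<And>w'. w' \<in> U \<Longrightarrow> norm w' = 1 \<Longrightarrow> cis (2 * pi * \<theta> w' / T) = w'"
    "(\<theta> has_derivative (\<lambda>v. T / (2 * pi) * Im (v / w))) (at w)"
proof
  define U where "U = {w'. Re (cnj w * w') > 0}"
  define \<theta> where "\<theta> w' = u + T / (2 * pi) * Im (Ln (cnj w * w'))" for w'
  have w: "norm w = 1" using assms(2) by auto
  then have w1: "cnj w * w = 1" "w \<noteq> 0" "cnj w \<noteq> 0"
    by (auto simp: complex_cnj_mult complex_norm_square[symmetric] mult.commute)
  show "open U" unfolding U_def by (intro open_Collect_less continuous_intros)
  show "w \<in> U" unfolding U_def mem_Collect_eq w1(1) by simp
  have nonpos: "cnj w * w' \<notin> \<real>\<^sub>\<le>\<^sub>0" if "w' \<in> U" for w'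
    using that by (simp add: U_def complex_nonpos_Reals_iff)
  show "smooth_on U \<theta>"
    unfolding \<theta>_def by (intro smooth_on_intros \<open>open U\<close> smooth_on_Im_Ln w1 nonpos)
  show "\<theta> w = u" by (simp add: \<theta>_def w1)
  show "cis (2 * pi * \<theta> w' / T) = w'" if "w' \<in> U" "norm w' = 1" for w'
  proof -
    have "2 * pi * \<theta> w' / T = 2 * pi * u / T + Im (Ln (cnj w * w'))"
      using assms(1) by (simp add: \<theta>_def field_simps)
    moreover have "cis (Im (Ln (cnj w * w'))) = cnj w * w'"
    proof -
      have "cnj w * w' \<noteq> 0" using w1 that by auto
      then have "exp (Ln (cnj w * w')) = cnj w * w'" by simp
      moreover have "Re (Ln (cnj w * w')) = 0"
        using w that \<open>cnj w * w' \<noteq> 0\<close> by (simp add: norm_mult)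
      ultimately show ?thesis by (simp add: exp_eq_polar)
    qed
    ultimately have "cis (2 * pi * \<theta> w' / T) = w * (cnj w * w')"
      by (simp add: cis_mult[symmetric] assms(2))
    then show ?thesis using w1 by (metis mult.assoc mult.commute mult_1)
  qed
  have "((\<lambda>w'. Ln (cnj w * w')) has_field_derivative (1 / w)) (at w)"
    using w1 nonpos[OF \<open>w \<in> U\<close>] by (auto intro!: derivative_eq_intros simp: field_simps)
  then have "((\<lambda>w'. Ln (cnj w * w')) has_derivative (\<lambda>v. v / w)) (at w)"
    by (auto simp: has_field_derivative_def elim!: has_derivative_eq_rhs)
  then show "(\<theta> has_derivative (\<lambda>v. T / (2 * pi) * Im (v / w))) (at w)"
    unfolding \<theta>_def by (auto intro!: derivative_eq_intros)
qed

text \<open>The map that a curve of period \<open>T\<close> induces on the circle times the sphere.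
  \<open>Arg\<close> merely selects a parameter: its jump does not matter for periodic
  \<open>z\<close> and \<open>b\<close>, and near a given point it is replaced by a smooth local
  angle.\<close>

definition revolve :: "real \<Rightarrow> (real \<Rightarrow> complex) \<Rightarrow> (real \<Rightarrow> real) \<Rightarrow>
    complex \<times> (real ^ 'm) \<Rightarrow> complex \<times> (real ^ 'm)" where
  "revolve T z b q =
    (z (T / (2 * pi) * Arg (fst q)), b (T / (2 * pi) * Arg (fst q)) *\<^sub>R snd q)"

lemma revolve_eq:
  assumes "T > 0" "\<And>u. z (u + T) = z u" "\<And>u. b (u + T) = b u" "cis (2 * pi * u / T) = w"
  shows "revolve T z b (w, x) = (z u, b u *\<^sub>R x)"
proof -
  have "w \<noteq> 0" "norm w = 1" using assms(4) by auto
  then have *: "cis (2 * pi * (T / (2 * pi) * Arg w) / T) = cis (2 * pi * u / T)"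
    using assms(1,4) by (simp add: cis_Arg sgn_div_norm)
  have "z (T / (2 * pi) * Arg w) = z u"
    by (rule periodic_cis_eq[of T z, OF assms(1,2) *])
  moreover have "b (T / (2 * pi) * Arg w) = b u"
    by (rule periodic_cis_eq[of T b, OF assms(1,3) *])
  ultimately show ?thesis by (simp add: revolve_def)
qed

lemma smooth_revolve:
  assumes "T > 0" "\<And>u. z (u + T) = z u" "\<And>u. b (u + T) = b u"
    and "smooth_on UNIV z" "smooth_on UNIV b"
  shows "smooth_map_on circle_sphere (revolve T z b :: _ \<Rightarrow> complex \<times> (real ^ 'm))"
  unfolding smooth_map_on_def
proof
  fix q :: "complex \<times> (real ^ 'm)"
  assume q: "q \<in> circle_sphere"
  have "cis (2 * pi * (T / (2 * pi) * Arg (fst q)) / T) = fst q"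
  proof -
    have "norm (fst q) = 1" "fst q \<noteq> 0" using q by (auto simp: circle_sphere_def)
    then show ?thesis using assms(1) cis_Arg[of "fst q"] by (simp add: sgn_div_norm)
  qed
  then obtain U \<theta> where U: "open U" "fst q \<in> U" "smooth_on U \<theta>"
    "\<And>w'. w' \<in> U \<Longrightarrow> norm w' = 1 \<Longrightarrow> cis (2 * pi * \<theta> w' / T) = w'"
    by (rule local_angle[OF assms(1)]) blast
  define g where "g p = (z (\<theta> (fst p)), b (\<theta> (fst p)) *\<^sub>R snd p)" for p :: "complex \<times> (real ^ 'm)"
  have op: "open (U \<times> (UNIV :: (real ^ 'm) set))" using U(1) by (simp add: open_Times)
  have "smooth_on (U \<times> UNIV) g"
    unfolding g_def
    by (intro smooth_on_Pair smooth_on_scaleR op smooth_on_compose_real[OF op assms(4)]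
        smooth_on_compose_real[OF op assms(5)] smooth_on_compose_fst U
        smooth_on_bounded_linear[OF bounded_linear_snd op smooth_on_id[OF op]])
  moreover have "g y = revolve T z b y" if "y \<in> (U \<times> UNIV) \<inter> circle_sphere" for y
  proof -
    have "cis (2 * pi * \<theta> (fst y) / T) = fst y"
      using that by (auto intro!: U(4) simp: circle_sphere_def)
    from revolve_eq[of T z b, OF assms(1-3) this, of "snd y"] show ?thesis by (simp add: g_def)
  qed
  ultimately show "\<exists>U g. open U \<and> q \<in> U \<and> (\<forall>k. times_differentiable_on k U g) \<and>
       (\<forall>y \<in> U \<inter> circle_sphere. g y = revolve T z b y)"
    using op U(2) by (intro exI[of _ "U \<times> UNIV"] exI[of _ g]) (auto simp: smooth_on_def mem_Times_iff)
qed

text \<open>The factor \<open>T / (2 * pi) * Im (fst v / w)\<close> is the rate of change of the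
  curve parameter along \<open>v\<close>. The formula is the derivative of the extension by a local
  angle, which agrees with \<open>revolve\<close> on \<open>circle_sphere\<close> near the
  point.\<close>

lemma revolve_has_derivative:
  assumes "T > 0" "\<And>u. z (u + T) = z u" "\<And>u. b (u + T) = b u"
    and "cis (2 * pi * u / T) = w" "norm x = 1"
    and z': "(z has_vector_derivative z') (at u)" and b': "(b has_vector_derivative b') (at u)"
  shows "((revolve T z b :: _ \<Rightarrow> complex \<times> (real ^ 'm)) has_derivative
      (\<lambda>v. ((T / (2 * pi) * Im (fst v / w)) *\<^sub>R z',
        (T / (2 * pi) * Im (fst v / w) * b') *\<^sub>R x + b u *\<^sub>R snd v))) (at (w, x) within circle_sphere)"
proof -
  obtain U \<theta> where U: "open U" "w \<in> U" "\<theta> w = u"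
    "\<And>w'. w' \<in> U \<Longrightarrow> norm w' = 1 \<Longrightarrow> cis (2 * pi * \<theta> w' / T) = w'"
    and D: "(\<theta> has_derivative (\<lambda>v. T / (2 * pi) * Im (v / w))) (at w)"
    by (rule local_angle[OF assms(1,4)]) blast
  obtain \<epsilon> where \<epsilon>: "\<epsilon> > 0" "ball w \<epsilon> \<subseteq> U" using U(1,2) openE by blast
  have q: "(w, x) \<in> circle_sphere" using assms(4,5) by (auto simp: circle_sphere_def)
  have "((\<lambda>p. \<theta> (fst p)) has_derivative (\<lambda>v. T / (2 * pi) * Im (fst v / w))) (at (w, x))"
    by (rule has_derivative_compose[where f = fst and f' = fst and g = \<theta>])
       (use D in \<open>auto intro!: derivative_eq_intros\<close>)
  note A = this
  have Z: "((\<lambda>p. z (\<theta> (fst p))) has_derivative (\<lambda>v. (T / (2 * pi) * Im (fst v / w)) *\<^sub>R z')) (at (w, x))"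
    using has_derivative_compose[OF A, of z "\<lambda>t. t *\<^sub>R z'"] z' U(3)
    by (simp add: has_vector_derivative_def)
  have B: "((\<lambda>p. b (\<theta> (fst p))) has_derivative (\<lambda>v. (T / (2 * pi) * Im (fst v / w)) *\<^sub>R b')) (at (w, x))"
    using has_derivative_compose[OF A, of b "\<lambda>t. t *\<^sub>R b'"] b' U(3)
    by (simp add: has_vector_derivative_def)
  have "((\<lambda>p. (z (\<theta> (fst p)), b (\<theta> (fst p)) *\<^sub>R snd p)) has_derivative
      (\<lambda>v. ((T / (2 * pi) * Im (fst v / w)) *\<^sub>R z',
        (T / (2 * pi) * Im (fst v / w) * b') *\<^sub>R x + b u *\<^sub>R snd v))) (at (w, x))"
    by (rule has_derivative_eq_rhs, rule has_derivative_Pair[OF Z has_derivative_scaleR[OF B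
        has_derivative_snd[OF has_derivative_ident]]])
       (auto simp: U(3) fun_eq_iff add.commute)
  then have *: "((\<lambda>p. (z (\<theta> (fst p)), b (\<theta> (fst p)) *\<^sub>R snd p)) has_derivative
      (\<lambda>v. ((T / (2 * pi) * Im (fst v / w)) *\<^sub>R z',
        (T / (2 * pi) * Im (fst v / w) * b') *\<^sub>R x + b u *\<^sub>R snd v))) (at (w, x) within circle_sphere)"
    by (rule has_derivative_at_withinI)
  show ?thesis
  proof (rule has_derivative_transform_within[OF * \<epsilon>(1) q])
    fix p :: "complex \<times> (real ^ 'm)" assume p: "p \<in> circle_sphere" "dist p (w, x) < \<epsilon>"
    have "dist (fst p) w < \<epsilon>"
      using p(2) dist_fst_le[of p "(w, x)"] by simp
    then have "fst p \<in> U" using \<epsilon>(2) by (auto simp: dist_commute)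
    then show "(z (\<theta> (fst p)), b (\<theta> (fst p)) *\<^sub>R snd p) = revolve T z b p"
    proof -
      have "cis (2 * pi * \<theta> (fst p) / T) = fst p"
        using p(1) \<open>fst p \<in> U\<close> by (auto intro!: U(4) simp: circle_sphere_def)
      from revolve_eq[of T z b, OF assms(1-3) this, of "snd p"] show ?thesis by simp
    qed
  qed
qed

text \<open>The curve \<open>(z, b)\<close> has tangent \<open>(z', b')\<close> and principal curvature \<open>- \<kappa>\<close> with respect to
  \<open>(nz, nb)\<close>; the other principal curvatures of the generated hypersurface are all \<open>- nb / b\<close>.\<close>

lemma cmc_immersion_revolve:
  fixes z z' nz :: "real \<Rightarrow> complex" and b b' nb \<kappa> :: "real \<Rightarrow> real" and T H :: real
  assumes T: "T > 0"
    and per: "\<And>u. z (u + T) = z u" "\<And>u. b (u + T) = b u"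
      "\<And>u. nz (u + T) = nz u" "\<And>u. nb (u + T) = nb u"
    and sm: "smooth_on UNIV z" "smooth_on UNIV b" "smooth_on UNIV nz" "smooth_on UNIV nb"
    and z': "\<And>u. (z has_vector_derivative z' u) (at u)"
    and b': "\<And>u. (b has_vector_derivative b' u) (at u)"
    and nz': "\<And>u. (nz has_vector_derivative \<kappa> u *\<^sub>R z' u) (at u)"
    and nb': "\<And>u. (nb has_vector_derivative \<kappa> u * b' u) (at u)"
    and unit: "\<And>u. z u \<bullet> z u + b u * b u = 1" "\<And>u. nz u \<bullet> nz u + nb u * nb u = 1"
    and orth: "\<And>u. nz u \<bullet> z u + nb u * b u = 0" "\<And>u. nz u \<bullet> z' u + nb u * b' u = 0"
    and pos: "\<And>u. b u > 0" and reg: "\<And>u. (z' u, b' u) \<noteq> 0"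
    and H: "\<And>u. - \<kappa> u - real (CARD('m) - 1) * (nb u / b u) = H"
  shows "cmc_immersion (revolve T z b :: _ \<Rightarrow> complex \<times> (real ^ 'm)) (revolve T nz nb) H"
proof -
  let ?F = "revolve T z b :: _ \<Rightarrow> complex \<times> (real ^ 'm)"
  let ?N = "revolve T nz nb :: _ \<Rightarrow> complex \<times> (real ^ 'm)"
  let ?S = "circle_sphere :: (complex \<times> (real ^ 'm)) set"
  let ?t = "\<lambda>w v. T / (2 * pi) * Im (v / w)"
  let ?D = "\<lambda>u w x v. (?t w (fst v) *\<^sub>R z' u, (?t w (fst v) * b' u) *\<^sub>R x + b u *\<^sub>R snd v)"
  let ?E = "\<lambda>u w x v. (?t w (fst v) *\<^sub>R (\<kappa> u *\<^sub>R z' u), (?t w (fst v) * (\<kappa> u * b' u)) *\<^sub>R x + nb u *\<^sub>R snd v)"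
  have pt: "\<exists>u w x. q = (w, x) \<and> cis (2 * pi * u / T) = w \<and> norm w = 1 \<and> x \<bullet> x = 1 \<and> norm x = 1"
    if "q \<in> ?S" for q
  proof (intro exI conjI)
    show "q = (fst q, snd q)" by simp
    show "cis (2 * pi * (T / (2 * pi) * Arg (fst q)) / T) = fst q"
    proof -
      have "norm (fst q) = 1" "fst q \<noteq> 0" using that by (auto simp: circle_sphere_def)
      then show ?thesis using T cis_Arg[of "fst q"] by (simp add: sgn_div_norm)
    qed
  qed (use that in \<open>auto simp: circle_sphere_def norm_eq_1\<close>)
  have F: "(?F has_derivative ?D u w x) (at (w, x) within ?S)"
    and N: "(?N has_derivative ?E u w x) (at (w, x) within ?S)"
    if "cis (2 * pi * u / T) = w" "norm x = 1" for u w x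
    by (rule revolve_has_derivative[OF T per(1,2) that z' b'],
        rule revolve_has_derivative[OF T per(3,4) that nz' nb'])
  have FN: "?F (w, x) = (z u, b u *\<^sub>R x)" "?N (w, x) = (nz u, nb u *\<^sub>R x)"
    if "cis (2 * pi * u / T) = w" for u w x
    using revolve_eq[of T z b, OF T per(1,2) that] revolve_eq[of T nz nb, OF T per(3,4) that] by auto
  have inj: "inj_on (?D u w x) (circle_sphere_tangent (w, x))"
    if "norm w = 1" "x \<bullet> x = 1" for u w and x :: "real ^ 'm"
  proof (rule inj_onI)
    fix p q assume p: "p \<in> circle_sphere_tangent (w, x)" and q: "q \<in> circle_sphere_tangent (w, x)"
      and eq: "?D u w x p = ?D u w x q"
    have orth: "w \<bullet> fst p = 0" "w \<bullet> fst q = 0" "x \<bullet> snd p = 0" "x \<bullet> snd q = 0"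
      using p q by (auto simp: circle_sphere_tangent_def)
    define s t where "s = ?t w (fst p)" and "t = ?t w (fst q)"
    have e1: "s *\<^sub>R z' u = t *\<^sub>R z' u"
      and e2: "(s * b' u) *\<^sub>R x + b u *\<^sub>R snd p = (t * b' u) *\<^sub>R x + b u *\<^sub>R snd q"
      using eq by (auto simp: s_def t_def)
    \<comment> \<open>Tangency makes \<open>snd p\<close> and \<open>snd q\<close> orthogonal to
      \<open>x\<close>, so this inner product isolates the \<open>b'\<close> component; regularity
      of the curve then forces \<open>s = t\<close>.\<close>
    have "x \<bullet> ((s * b' u) *\<^sub>R x + b u *\<^sub>R snd p) = x \<bullet> ((t * b' u) *\<^sub>R x + b u *\<^sub>R snd q)"
      using e2 by simp
    then have "s * b' u = t * b' u" using orth that(2) by (simp add: inner_add_right)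
    with e1 reg[of u] have st: "s = t" by (auto simp: zero_prod_def)
    with e2 pos[of u] have "snd p = snd q" by simp
    moreover have "Im (fst p / w) = Im (fst q / w)" using st T by (simp add: s_def t_def)
    moreover have "Re (fst p / w) = 0" "Re (fst q / w) = 0"
      using orth by (auto simp: Re_divide inner_complex_def algebra_simps)
    ultimately have "fst p / w = fst q / w" by (simp add: complex_eq_iff)
    then have "fst p = fst q" using that(1) by auto
    with \<open>snd p = snd q\<close> show "p = q" by (simp add: prod_eq_iff)
  qed
  have "immersion_into_sphere ?F"
    unfolding immersion_into_sphere_def
  proof (intro conjI ballI)
    show "smooth_map_on ?S ?F" by (rule smooth_revolve[OF T per(1,2) sm(1,2)])
    show "?F ` ?S \<subseteq> sphere 0 1"
    proof (rule image_subsetI)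
      fix q assume "q \<in> ?S"
      then obtain u w x where u: "q = (w, x)" "cis (2 * pi * u / T) = w" "x \<bullet> x = 1"
        using pt by blast
      show "?F q \<in> sphere 0 1"
        using unit(1)[of u] u(3) by (simp add: u(1) FN(1)[OF u(2)] norm_eq_1)
    qed
    fix q assume "q \<in> ?S"
    then obtain u w x where q: "q = (w, x)" "cis (2 * pi * u / T) = w" "norm w = 1" "x \<bullet> x = 1"
      "norm x = 1" using pt by blast
    show "\<exists>D. (?F has_derivative D) (at q within ?S) \<and> inj_on D (circle_sphere_tangent q)"
      using F[OF q(2,5)] inj[OF q(3,4), of u] q(1) by blast
  qed
  moreover have "unit_normal_field ?F ?N"
    unfolding unit_normal_field_def
  proof (intro conjI ballI)
    show "smooth_map_on ?S ?N" by (rule smooth_revolve[OF T per(3,4) sm(3,4)])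
    fix q assume "q \<in> ?S"
    then obtain u w x where q: "q = (w, x)" "cis (2 * pi * u / T) = w" "norm w = 1" "x \<bullet> x = 1"
      "norm x = 1" using pt by blast
    show "norm (?N q) = 1" using unit(2)[of u] q(4) by (simp add: q(1) FN(2)[OF q(2)] norm_eq_1)
    show "?N q \<bullet> ?F q = 0" using orth(1)[of u] q(4) by (simp add: q(1) FN[OF q(2)] mult.commute)
    have "?N q \<bullet> ?D u w x v = 0" if "v \<in> circle_sphere_tangent q" for v
    proof -
      have "x \<bullet> snd v = 0" using that q(1) by (auto simp: circle_sphere_tangent_def)
      then have "?N q \<bullet> ?D u w x v = ?t w (fst v) * (nz u \<bullet> z' u + nb u * b' u)"
        using q(4) by (simp add: q(1) FN[OF q(2)] inner_add_right algebra_simps add_divide_distrib)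
      then show ?thesis by (simp add: orth(2))
    qed
    then show "\<exists>D. (?F has_derivative D) (at q within ?S) \<and>
        (\<forall>v \<in> circle_sphere_tangent q. ?N q \<bullet> D v = 0)"
      using F[OF q(2,5)] q(1) by blast
  qed
  moreover have "has_mean_curvature_at ?F ?N H q" if qS: "q \<in> ?S" for q
  proof -
    obtain u w x where q: "q = (w, x)" "cis (2 * pi * u / T) = w" "norm w = 1" "x \<bullet> x = 1"
      "norm x = 1" using pt[OF qS] by blast
    define S where "S = {y. x \<bullet> y = 0}"
    obtain A where A: "A \<subseteq> S" "pairwise orthogonal A" "\<And>y. y \<in> A \<Longrightarrow> norm y = 1"
      "independent A" "card A = dim S"
      using orthonormal_basis_subspace[of S] subspace_hyperplane[of x] unfolding S_def by metis
    have "x \<noteq> 0" using q(4) by auto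
    then have cA: "finite A" "card A = CARD('m) - 1"
      using A(4,5) dim_hyperplane[of x] by (auto simp: S_def independent_imp_finite)
    define \<rho> where "\<rho> = norm (z' u, b' u)"
    have \<rho>: "\<rho> > 0" "\<rho> * \<rho> = z' u \<bullet> z' u + b' u * b' u"
      using reg[of u] by (auto simp: \<rho>_def dot_square_norm[symmetric] power2_eq_square[symmetric])
    \<comment> \<open>This multiple of the circle direction \<open>\<i> * w\<close> moves the curve
      parameter at rate \<open>1 / \<rho>\<close>, hence has an image of length one. In the sphere
      directions the map scales by \<open>b u\<close>, which explains the division by
      \<open>b u\<close> in \<open>B\<close>.\<close>
    define v0 where "v0 = (\<i> * w * of_real (2 * pi / (T * \<rho>)), 0 :: real ^ 'm)"
    define B where "B = insert v0 ((\<lambda>y. (0, (1 / b u) *\<^sub>R y)) ` A)"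
    have w0: "w \<noteq> 0" using q(3) by auto
    have t0: "?t w (fst v0) = 1 / \<rho>"
      using T \<rho>(1) w0 by (simp add: v0_def)
    have Dv0: "?D u w x v0 = ((1 / \<rho>) *\<^sub>R z' u, (b' u / \<rho>) *\<^sub>R x)"
      and Ev0: "?E u w x v0 = ((1 / \<rho>) *\<^sub>R (\<kappa> u *\<^sub>R z' u), (\<kappa> u * b' u / \<rho>) *\<^sub>R x)"
      unfolding t0 by (simp_all add: v0_def)
    have Dy: "?D u w x (0, (1 / b u) *\<^sub>R y) = (0, y)"
      and Ey: "?E u w x (0, (1 / b u) *\<^sub>R y) = (0, (nb u / b u) *\<^sub>R y)" for y
      using pos[of u] by auto
    have v0: "v0 \<notin> (\<lambda>y. (0, (1 / b u) *\<^sub>R y)) ` A"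
      using T \<rho>(1) w0 by (auto simp: v0_def)
    have injA: "inj_on (\<lambda>y. (0 :: complex, (1 / b u) *\<^sub>R y)) A"
      using pos[of u] by (auto simp: inj_on_def)
    have AA: "y \<bullet> y' = (if y = y' then 1 else 0)" if "y \<in> A" "y' \<in> A" for y y'
      using A(2,3) that by (auto simp: pairwise_def orthogonal_def norm_eq_1)
    have xA: "x \<bullet> y = 0" if "y \<in> A" for y using A(1) that by (auto simp: S_def)
    have D00: "?D u w x v0 \<bullet> ?D u w x v0 = 1"
    proof -
      have "?D u w x v0 \<bullet> ?D u w x v0 = (z' u \<bullet> z' u + b' u * b' u) / (\<rho> * \<rho>)"
        unfolding Dv0 using q(4) by (simp add: add_divide_distrib)
      then show ?thesis unfolding \<rho>(2)[symmetric] using \<rho>(1) by simp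
    qed
    have D0y: "?D u w x v0 \<bullet> (0, y) = 0" "(0, y) \<bullet> ?D u w x v0 = 0" if "y \<in> A" for y
      unfolding Dv0 using xA[OF that] by (simp_all add: inner_commute)
    have "?D u w x v \<bullet> ?D u w x v' = (if v = v' then 1 else 0)" if vB: "v \<in> B" "v' \<in> B" for v v'
    proof -
      consider "v = v0" "v' = v0"
        | y where "v = v0" "y \<in> A" "v' = (0, (1 / b u) *\<^sub>R y)"
        | y where "v' = v0" "y \<in> A" "v = (0, (1 / b u) *\<^sub>R y)"
        | y y' where "y \<in> A" "y' \<in> A" "v = (0, (1 / b u) *\<^sub>R y)" "v' = (0, (1 / b u) *\<^sub>R y')"
        using vB unfolding B_def by blast
      then show ?thesis
      proof cases
        case 1
        then show ?thesis using D00 by simp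
      next
        case 2
        then have "v \<noteq> v'" using v0 by blast
        then show ?thesis using D0y(1)[OF 2(2)] unfolding 2(1,3) Dy by simp
      next
        case 3
        then have "v \<noteq> v'" using v0 by blast
        then show ?thesis using D0y(2)[OF 3(2)] unfolding 3(1,3) Dy by simp
      next
        case 4
        then have "v = v' \<longleftrightarrow> y = y'" using inj_onD[OF injA] by blast
        then show ?thesis using AA[OF 4(1,2)] unfolding 4(3,4) Dy by simp
      qed
    qed
    moreover have "B \<subseteq> circle_sphere_tangent q"
      using xA by (auto simp: B_def circle_sphere_tangent_def q(1) v0_def inner_complex_def)
    moreover have "finite B" "card B = CARD('m)"
      using cA v0 by (auto simp: B_def card_image[OF injA])
    moreover have "(\<Sum>v\<in>B. - (?E u w x v \<bullet> ?D u w x v)) = H"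
    proof -
      have "?E u w x v0 \<bullet> ?D u w x v0 = \<kappa> u * (?D u w x v0 \<bullet> ?D u w x v0)"
        unfolding Dv0 Ev0 using \<rho>(1) by (simp add: field_simps)
      then have "?E u w x v0 \<bullet> ?D u w x v0 = \<kappa> u" using D00 by simp
      moreover have "(\<Sum>v\<in>(\<lambda>y. (0, (1 / b u) *\<^sub>R y)) ` A. - (?E u w x v \<bullet> ?D u w x v))
          = (\<Sum>y\<in>A. - (nb u / b u))"
        unfolding sum.reindex[OF injA] o_def Dy Ey using AA by (intro sum.cong) auto
      ultimately show ?thesis
        unfolding B_def using cA v0 H[of u] by (subst sum.insert) auto
    qed
    ultimately show ?thesis
      unfolding has_mean_curvature_at_def
      using F[OF q(2,5)] N[OF q(2,5)] unfolding q(1) by blast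
  qed
  ultimately show ?thesis by (simp add: cmc_immersion_def)
qed

subsection \<open>The phase gained over a period\<close>

text \<open>With \<open>x = sin s\<close>, \<open>\<beta> = sin z\<^sub>L\<close> and \<open>m = n - 1\<close>, the function \<open>L\<^sup>2 - R\<^sup>2\<close> is
  \<open>x ^ (2 * (m - 1)) * (1 - x) * (x - \<beta>)\<close> times a positive constant times \<open>flower_M m \<beta> x\<close>.
  Dividing out the two simple zeros explicitly is what keeps the curve smooth at the ends of its pieces.\<close>

definition recip_sum :: "nat \<Rightarrow> real \<Rightarrow> real" where
  "recip_sum m b = (\<Sum>j<m. (1 / b) ^ j)"

text \<open>The quotient of \<open>recip_sum m \<beta> - recip_sum m b\<close> by
  \<open>b - \<beta>\<close> with the division carried out, hence regular also at
  \<open>b = \<beta>\<close>.\<close>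

definition recip_slope :: "nat \<Rightarrow> real \<Rightarrow> real \<Rightarrow> real" where
  "recip_slope m \<beta> b = (\<Sum>j<m. \<Sum>i<j. (1 / b) ^ (j - Suc i) * (1 / \<beta>) ^ i) / (\<beta> * b)"

definition flower_M :: "nat \<Rightarrow> real \<Rightarrow> real \<Rightarrow> real" where
  "flower_M m \<beta> b = 2 * (recip_sum m \<beta>)\<^sup>2 +
    (1 + \<beta>) * (1 - b) * (recip_sum m \<beta> + recip_sum m b) * recip_slope m \<beta> b"

text \<open>Angular momentum over squared radius, times the speed \<open>sqrt (1 - \<beta>) *
  recip_sum m \<beta> / sqrt (flower_M m \<beta> b)\<close> in the parameter \<open>u\<close>. A
  common factor \<open>1 - b\<close> has been cancelled, so the value at the pole is finite and
  positive.\<close>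

definition phase_speed :: "nat \<Rightarrow> real \<Rightarrow> real \<Rightarrow> real" where
  "phase_speed m \<beta> b = recip_sum m b / (1 + b) * sqrt ((1 + \<beta>) / flower_M m \<beta> b)"

definition flower_height :: "real \<Rightarrow> real \<Rightarrow> real" where
  "flower_height \<beta> u = (1 + \<beta>) / 2 + (1 - \<beta>) / 2 * cos u"

definition flower_period :: "nat \<Rightarrow> real \<Rightarrow> real" where
  "flower_period m \<beta> = integral {0..2 * pi} (\<lambda>u. phase_speed m \<beta> (flower_height \<beta> u))"

text \<open>This is \<open>h / m\<close>, obtained by solving \<open>flower_L = flower_R\<close> at
  \<open>sin s = \<beta>\<close> for \<open>h\<close>.\<close>

definition flower_kappa :: "nat \<Rightarrow> real \<Rightarrow> real" where
  "flower_kappa m \<beta> = sqrt ((1 + \<beta>) / (1 - \<beta>)) / recip_sum m \<beta>"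

lemma recip_sum_diff:
  assumes "\<beta> \<noteq> 0" "b \<noteq> 0"
  shows "recip_sum m \<beta> - recip_sum m b = (b - \<beta>) * recip_slope m \<beta> b"
proof -
  have d: "1 / \<beta> - 1 / b = (b - \<beta>) / (\<beta> * b)"
    using assms by (simp add: field_simps)
  have "recip_sum m \<beta> - recip_sum m b = (\<Sum>j<m. (1 / \<beta>) ^ j - (1 / b) ^ j)"
    by (simp add: recip_sum_def sum_subtractf)
  also have "\<dots> = (\<Sum>j<m. (1 / \<beta> - 1 / b) * (\<Sum>i<j. (1 / b) ^ (j - Suc i) * (1 / \<beta>) ^ i))"
    by (intro sum.cong refl power_diff_sumr2)
  also have "\<dots> = (b - \<beta>) * recip_slope m \<beta> b"
    unfolding d recip_slope_def by (simp flip: sum_distrib_left sum_divide_distrib)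
  finally show ?thesis .
qed

lemma recip_sum_pos: "m > 0 \<Longrightarrow> b > 0 \<Longrightarrow> recip_sum m b > 0"
  unfolding recip_sum_def by (intro sum_pos) auto

lemma recip_slope_nonneg: "\<beta> > 0 \<Longrightarrow> b > 0 \<Longrightarrow> recip_slope m \<beta> b \<ge> 0"
  unfolding recip_slope_def by (intro divide_nonneg_pos sum_nonneg) auto

lemma recip_sum_antimono: "0 < \<beta> \<Longrightarrow> \<beta> \<le> b \<Longrightarrow> recip_sum m b \<le> recip_sum m \<beta>"
  unfolding recip_sum_def by (intro sum_mono power_mono) (auto simp: frac_le)

lemma flower_M_ge:
  assumes "m > 0" "0 < \<beta>" "0 < b" "b \<le> 1"
  shows "flower_M m \<beta> b \<ge> 2 * (recip_sum m \<beta>)\<^sup>2"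
  using assms recip_slope_nonneg[of \<beta> b m] recip_sum_pos[of m b] recip_sum_pos[of m \<beta>]
  by (simp add: flower_M_def)

lemma flower_M_pos:
  assumes "m > 0" "0 < \<beta>" "0 < b" "b \<le> 1"
  shows "flower_M m \<beta> b > 0"
  using flower_M_ge[OF assms] recip_sum_pos[OF assms(1,2)] by (smt (verit) zero_less_power)

section \<open>The height function; continuity and positivity of the phase gain\<close>

lemma flower_height_eq:
  "1 - flower_height \<beta> u = (1 - \<beta>) * (sin (u / 2))\<^sup>2"
  "flower_height \<beta> u - \<beta> = (1 - \<beta>) * (cos (u / 2))\<^sup>2"
proof -
  have c: "cos u = 2 * (cos (u / 2))\<^sup>2 - 1" using cos_double_cos[of "u / 2"] by simp
  have s: "cos u = 1 - 2 * (sin (u / 2))\<^sup>2" using cos_double_sin[of "u / 2"] by simp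
  show "1 - flower_height \<beta> u = (1 - \<beta>) * (sin (u / 2))\<^sup>2"
    unfolding flower_height_def s by (simp add: field_simps)
  show "flower_height \<beta> u - \<beta> = (1 - \<beta>) * (cos (u / 2))\<^sup>2"
    unfolding flower_height_def c by (simp add: field_simps)
qed

lemma flower_height_bounds:
  assumes "0 < \<beta>" "\<beta> < 1"
  shows "\<beta> \<le> flower_height \<beta> u" "flower_height \<beta> u \<le> 1" "0 < flower_height \<beta> u"
proof -
  have "flower_height \<beta> u - \<beta> \<ge> 0" "1 - flower_height \<beta> u \<ge> 0"
    using assms unfolding flower_height_eq by auto
  then show "\<beta> \<le> flower_height \<beta> u" "flower_height \<beta> u \<le> 1" "0 < flower_height \<beta> u"
    using assms by auto
qed

lemma phase_speed_pos:
  assumes "m > 0" "0 < \<beta>" "\<beta> < 1" "0 < b" "b \<le> 1"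
  shows "phase_speed m \<beta> b > 0"
  using recip_sum_pos[of m b] flower_M_pos[of m \<beta> b] assms by (simp add: phase_speed_def)

lemma continuous_on_phase_speed:
  assumes "m > 0" "continuous_on S f" "continuous_on S g"
    and "\<And>x. x \<in> S \<Longrightarrow> 0 < f x" "\<And>x. x \<in> S \<Longrightarrow> 0 < g x" "\<And>x. x \<in> S \<Longrightarrow> g x \<le> 1"
  shows "continuous_on S (\<lambda>x. phase_speed m (f x) (g x))"
proof -
  have nz: "f x \<noteq> 0" "g x \<noteq> 0" "1 + g x \<noteq> 0" "flower_M m (f x) (g x) \<noteq> 0" if "x \<in> S" for x
    using assms(4,5)[OF that] flower_M_pos[OF assms(1,4-6), OF that that that] by auto
  have R: "continuous_on S (\<lambda>x. recip_sum m (f x))" "continuous_on S (\<lambda>x. recip_sum m (g x))"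
    unfolding recip_sum_def using nz assms(2,3) by (auto intro!: continuous_intros)
  have "continuous_on S (\<lambda>x. flower_M m (f x) (g x))"
    unfolding flower_M_def recip_slope_def using nz assms(2,3) R by (auto intro!: continuous_intros)
  then show ?thesis
    unfolding phase_speed_def using nz assms(2,3) R by (auto intro!: continuous_intros)
qed

lemma continuous_on_phase_speed_height:
  assumes "m > 0" "0 < \<beta>" "\<beta> < 1"
  shows "continuous_on S (\<lambda>u. phase_speed m \<beta> (flower_height \<beta> u))"
  using assms flower_height_bounds[of \<beta>]
  by (intro continuous_on_phase_speed) (auto simp: flower_height_def intro!: continuous_intros)

lemma continuous_on_flower_period:
  assumes "m > 0"
  shows "continuous_on {0<..<1} (flower_period m)"
proof -
  have "continuous_on ({0<..<1} \<times> cbox 0 (2 * pi))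
      (\<lambda>x. phase_speed m (fst x) (flower_height (fst x) (snd x)))"
    using flower_height_bounds
    by (intro continuous_on_phase_speed assms) (auto simp: flower_height_def intro!: continuous_intros)
  then have "continuous_on {0<..<1} (\<lambda>\<beta>. integral (cbox 0 (2 * pi))
      (\<lambda>u. phase_speed m \<beta> (flower_height \<beta> u)))"
    by (intro integral_continuous_on_param) (simp add: case_prod_unfold)
  then show ?thesis unfolding flower_period_def by simp
qed

lemma flower_period_pos:
  assumes "m > 0" "0 < \<beta>" "\<beta> < 1"
  shows "flower_period m \<beta> > 0"
proof -
  let ?f = "\<lambda>u. phase_speed m \<beta> (flower_height \<beta> u)"
  have pos: "?f u > 0" for u
    using flower_height_bounds[OF assms(2,3)] by (intro phase_speed_pos assms) auto
  have "flower_period m \<beta> \<noteq> 0"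
  proof
    assume "flower_period m \<beta> = 0"
    then have "?f 0 = 0"
      using integral_eq_0_iff[of 0 "2 * pi" ?f] continuous_on_phase_speed_height[OF assms] pos
      by (simp add: flower_period_def less_imp_le)
    with pos[of 0] show False by simp
  qed
  moreover have "flower_period m \<beta> \<ge> 0"
    unfolding flower_period_def
    using pos continuous_on_phase_speed_height[OF assms]
    by (intro integral_nonneg integrable_continuous_real) (auto simp: less_imp_le)
  ultimately show ?thesis by simp
qed

text \<open>The second summand of \<open>flower_M\<close> is nonnegative, so the square root is at
  most \<open>1 / recip_sum m \<beta>\<close>. The quotient of the two reciprocal sums is then
  estimated termwise after weighting them with \<open>b\<close> and \<open>\<beta>\<close>, which
  produces the explicitly integrable bound.\<close>

lemma phase_speed_le:
  assumes "m \<ge> 2" "0 < \<beta>" "\<beta> < 1" "\<beta> \<le> b" "b \<le> 1"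
  shows "phase_speed m \<beta> b \<le> m * \<beta> / b"
proof -
  let ?X = "recip_sum m b" and ?Y = "recip_sum m \<beta>"
  have X: "?X > 0" "?Y > 0" using assms by (auto intro: recip_sum_pos)
  have "(1 + \<beta>) / flower_M m \<beta> b \<le> 2 / (2 * ?Y\<^sup>2)"
    using assms X by (intro frac_le flower_M_ge) auto
  also have "\<dots> = (1 / ?Y)\<^sup>2" by (simp add: power_divide)
  finally have "sqrt ((1 + \<beta>) / flower_M m \<beta> b) \<le> 1 / ?Y"
    using X by (intro real_le_lsqrt) auto
  moreover have "?X / (1 + b) \<le> ?X / 1" using assms X by (intro divide_left_mono) auto
  ultimately have "phase_speed m \<beta> b \<le> ?X * (1 / ?Y)"
    unfolding phase_speed_def using X assms flower_M_pos[of m \<beta> b] by (intro mult_mono) auto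
  also have "\<dots> = (b * ?X) / (b * ?Y)" using assms by simp
  also have "b * ?X \<le> m * (\<beta> * ?Y)"
  proof -
    have le: "\<beta> * (1 / \<beta>) ^ j \<le> \<beta> * ?Y" if "j < m" for j
      unfolding recip_sum_def using assms that
      by (intro mult_left_mono member_le_sum) auto
    have "b * (1 / b) ^ j \<le> \<beta> * ?Y" if "j < m" for j
    \<comment> \<open>For \<open>j = 0\<close> the left side is \<open>b \<le> 1\<close>, and 1 is
      the weighted term of index 1 on the right, which is present because \<open>m \<ge> 2\<close>.
      For larger \<open>j\<close> the weight cancels one power and the bases compare.\<close>
    proof (cases j)
      case 0
      then show ?thesis using le[of 1] assms by simp
    next
      case (Suc i)
      have "b * (1 / b) ^ j = (1 / b) ^ i" using assms Suc by simp
      also have "\<dots> \<le> (1 / \<beta>) ^ i" using assms by (intro power_mono) (auto simp: frac_le)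
      also have "\<dots> = \<beta> * (1 / \<beta>) ^ j" using assms Suc by simp
      finally show ?thesis using le[OF that] by simp
    qed
    then have "(\<Sum>j<m. b * (1 / b) ^ j) \<le> (\<Sum>j<m. \<beta> * ?Y)" by (intro sum_mono) auto
    then show ?thesis by (simp add: recip_sum_def[of m b] sum_distrib_left)
  qed
  then have "(b * ?X) / (b * ?Y) \<le> (m * (\<beta> * ?Y)) / (b * ?Y)"
    using assms X by (intro divide_right_mono) auto
  also have "\<dots> = m * \<beta> / b" using X by simp
  finally show ?thesis .
qed

text \<open>Up to the factor \<open>2 / k\<close>, the antiderivative is \<open>arctan (k * tan (u / 2))\<close>, rewritten
  so that it has no jumps at the odd multiples of \<open>\<pi>\<close>.\<close>

lemma has_integral_inverse_height:
  assumes "k > 0" "k < 1"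
  shows "((\<lambda>u. 1 / flower_height (k\<^sup>2) u) has_integral (2 * pi / k)) {0..2 * pi}"
proof -
  define G where "G u = (2 / k) * (u / 2 - arctan ((1 - k) * (sin (u / 2) * cos (u / 2)) /
    ((cos (u / 2))\<^sup>2 + k * (sin (u / 2))\<^sup>2)))" for u
  have "(G has_real_derivative 1 / flower_height (k\<^sup>2) u) (at u)" for u
  proof -
    define s c where "s = sin (u / 2)" and "c = cos (u / 2)"
    have sc: "c\<^sup>2 + s\<^sup>2 = 1" by (simp add: s_def c_def)
    define d where "d = c\<^sup>2 + k * s\<^sup>2"
    have d: "d > 0"
    proof (cases "c = 0")
      case True then show ?thesis using sc assms by (simp add: d_def)
    next
      case False then show ?thesis using assms by (simp add: d_def add_pos_nonneg)
    qed
    define e where "e = c\<^sup>2 + k\<^sup>2 * s\<^sup>2"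
    have e: "e > 0"
    proof (cases "c = 0")
      case True then show ?thesis using sc assms by (simp add: e_def)
    next
      case False then show ?thesis using assms by (simp add: e_def add_pos_nonneg)
    qed
    have h: "flower_height (k\<^sup>2) u = e"
      using flower_height_eq(2)[of "k\<^sup>2" u] sc by (simp add: e_def s_def c_def sin_squared_eq algebra_simps)
    define r where "r = (1 - k) * (s * c) / d"
    define r' where "r' = (1 - k) * (c\<^sup>2 - k * s\<^sup>2) / (2 * d\<^sup>2)"
    have D: "((\<lambda>u. (1 - k) * (sin (u / 2) * cos (u / 2)) /
      ((cos (u / 2))\<^sup>2 + k * (sin (u / 2))\<^sup>2)) has_real_derivative r') (at u)"
    proof -
      have "((\<lambda>u. (1 - k) * (sin (u / 2) * cos (u / 2))) has_real_derivative
          (1 - k) * ((c * c - s * s) / 2)) (at u)"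
        unfolding s_def c_def by (auto intro!: derivative_eq_intros simp: field_simps)
      moreover have "((\<lambda>u. (cos (u / 2))\<^sup>2 + k * (sin (u / 2))\<^sup>2) has_real_derivative
          k * s * c - c * s) (at u)"
        unfolding s_def c_def by (auto intro!: derivative_eq_intros simp: field_simps)
      ultimately have "((\<lambda>u. (1 - k) * (sin (u / 2) * cos (u / 2)) /
        ((cos (u / 2))\<^sup>2 + k * (sin (u / 2))\<^sup>2)) has_real_derivative
        ((1 - k) * ((c * c - s * s) / 2) * d - (1 - k) * (s * c) * (k * s * c - c * s)) / (d * d)) (at u)"
        using d unfolding s_def c_def d_def by (intro DERIV_divide) auto
      moreover have "(1 - k) * ((c * c - s * s) / 2) * d - (1 - k) * (s * c) * (k * s * c - c * s)
        = (1 - k) * (c\<^sup>2 - k * s\<^sup>2) / 2 * (c\<^sup>2 + s\<^sup>2)"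
        unfolding d_def by (simp add: field_simps power2_eq_square)
      moreover have "r' = ((1 - k) * (c\<^sup>2 - k * s\<^sup>2) / 2 * (c\<^sup>2 + s\<^sup>2)) / (d * d)"
        unfolding sc r'_def by (simp add: power2_eq_square)
      ultimately show ?thesis by (simp only:)
    qed
    have "(G has_real_derivative (2 / k) * (1 / 2 - r' / (1 + r\<^sup>2))) (at u)"
    proof -
      have "((\<lambda>u. arctan ((1 - k) * (sin (u / 2) * cos (u / 2)) /
        ((cos (u / 2))\<^sup>2 + k * (sin (u / 2))\<^sup>2))) has_real_derivative inverse (1 + r\<^sup>2) * r') (at u)"
        using DERIV_chain2[OF DERIV_arctan D] by (simp add: r_def s_def c_def d_def)
      moreover have "((\<lambda>u. u / 2) has_real_derivative 1 / 2) (at u)"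
        by (auto intro!: derivative_eq_intros)
      ultimately have "(G has_real_derivative (2 / k) * (1 / 2 - inverse (1 + r\<^sup>2) * r')) (at u)"
        unfolding G_def by (intro DERIV_cmult DERIV_diff)
      then show ?thesis by (simp only: divide_inverse mult.commute)
    qed
    moreover have "(2 / k) * (1 / 2 - r' / (1 + r\<^sup>2)) = 1 / e"
    proof -
      have "d\<^sup>2 * (1 + r\<^sup>2) = d\<^sup>2 + (1 - k)\<^sup>2 * (s * c)\<^sup>2"
        using d by (simp add: r_def power_divide power_mult_distrib distrib_left)
      also have "\<dots> = e * (c\<^sup>2 + s\<^sup>2)"
        unfolding d_def e_def by (simp add: algebra_simps power2_eq_square)
      finally have *: "d\<^sup>2 * (1 + r\<^sup>2) = e" using sc by simp
      have "r' / (1 + r\<^sup>2) = (1 - k) * (c\<^sup>2 - k * s\<^sup>2) / (2 * (d\<^sup>2 * (1 + r\<^sup>2)))"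
        by (simp add: r'_def)
      also have "\<dots> = (e - k * (c\<^sup>2 + s\<^sup>2)) / (2 * e)"
        unfolding * by (simp add: e_def algebra_simps power2_eq_square)
      also have "\<dots> = 1 / 2 - k / (2 * e)"
        using e sc by (simp add: diff_divide_distrib)
      finally show ?thesis using assms e by simp
    qed
    ultimately show ?thesis by (simp add: h)
  qed
  then have "((\<lambda>u. 1 / flower_height (k\<^sup>2) u) has_integral (G (2 * pi) - G 0)) {0..2 * pi}"
    by (intro fundamental_theorem_of_calculus)
       (auto simp: has_real_derivative_iff_has_vector_derivative[symmetric]
         intro: has_field_derivative_at_within)
  then show ?thesis by (simp add: G_def)
qed

text \<open>The integral of the inverse height grows only like \<open>1 / sqrt \<beta>\<close>, so
  the factor \<open>\<beta>\<close> in the bound of the phase speed leaves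
  \<open>sqrt \<beta>\<close>.\<close>

lemma flower_period_le:
  assumes "m \<ge> 2" "0 < \<beta>" "\<beta> < 1"
  shows "flower_period m \<beta> \<le> 2 * pi * m * sqrt \<beta>"
proof -
  have I: "((\<lambda>u. m * \<beta> * (1 / flower_height \<beta> u)) has_integral (m * \<beta> * (2 * pi / sqrt \<beta>))) {0..2 * pi}"
    using has_integral_mult_right[OF has_integral_inverse_height[of "sqrt \<beta>"]] assms by simp
  have "flower_period m \<beta> \<le> m * \<beta> * (2 * pi / sqrt \<beta>)"
    unfolding flower_period_def
  proof (rule has_integral_le[OF integrable_integral I])
    show "(\<lambda>u. phase_speed m \<beta> (flower_height \<beta> u)) integrable_on {0..2 * pi}"
      using assms by (intro integrable_continuous_real continuous_on_phase_speed_height) auto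
    show "phase_speed m \<beta> (flower_height \<beta> u) \<le> m * \<beta> * (1 / flower_height \<beta> u)" for u
      using phase_speed_le[OF assms flower_height_bounds(1,2)[OF assms(2,3)]] by simp
  qed
  also have "\<dots> = 2 * pi * m * (\<beta> / sqrt \<beta>)" by simp
  also have "\<beta> / sqrt \<beta> = sqrt \<beta>" using assms by (simp add: real_div_sqrt)
  finally show ?thesis .
qed

section \<open>Infinitely many rational phase gains, and injectivity of the curvature
  parameter\<close>

lemma infinite_Rats_between:
  fixes a b :: real
  assumes "a < b"
  shows "infinite (\<rat> \<inter> {a<..<b})"
proof
  assume fin: "finite (\<rat> \<inter> {a<..<b})"
  obtain r where "r \<in> \<rat> \<inter> {a<..<b}" using Rats_dense_in_real[OF assms] by auto
  then have "Min (\<rat> \<inter> {a<..<b}) \<in> \<rat> \<inter> {a<..<b}" using fin by (intro Min_in) auto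
  moreover from this obtain r' where "r' \<in> \<rat>" "a < r'" "r' < Min (\<rat> \<inter> {a<..<b})"
    using Rats_dense_in_real[of a "Min (\<rat> \<inter> {a<..<b})"] by auto
  ultimately have "Min (\<rat> \<inter> {a<..<b}) \<le> r'" using fin by (intro Min_le) auto
  with \<open>r' < _\<close> show False by simp
qed

lemma infinite_rational_periods:
  assumes "m \<ge> 2"
  shows "infinite {\<beta> \<in> {0<..<1}. flower_period m \<beta> / (2 * pi) \<in> \<rat>}"
proof
  let ?S = "{\<beta> \<in> {0<..<1}. flower_period m \<beta> / (2 * pi) \<in> \<rat>}"
  let ?P = "\<lambda>\<beta>. flower_period m \<beta> / (2 * pi)"
  assume fin: "finite ?S"
  \<comment> \<open>Chosen so that \<open>m * e\<close> is half the value at \<open>1 / 2\<close>.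
    With \<open>sqrt \<beta> \<le> e\<close> the gain at \<open>\<beta>\<close> is then strictly
    smaller than at \<open>1 / 2\<close>, and by connectedness a nondegenerate interval of gains is
    attained.\<close>
  define e where "e = ?P (1 / 2) / (2 * m)"
  have "?P (1 / 2) > 0" using flower_period_pos[of m "1 / 2"] assms by simp
  moreover have "real (2 * m) > 0" using assms by simp
  ultimately have e: "e > 0" unfolding e_def by (rule divide_pos_pos)
  define \<beta> where "\<beta> = min (1 / 2) (e\<^sup>2)"
  have \<beta>: "0 < \<beta>" "\<beta> < 1" using e by (auto simp: \<beta>_def)
  have "sqrt \<beta> \<le> e" using e by (intro real_le_lsqrt) (auto simp: \<beta>_def)
  have "?P \<beta> \<le> m * sqrt \<beta>" using flower_period_le[OF assms \<beta>] by (simp add: field_simps)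
  also have "\<dots> \<le> m * e" using \<open>sqrt \<beta> \<le> e\<close> by (intro mult_left_mono) auto
  also have "\<dots> = ?P (1 / 2) / 2" using assms by (simp add: e_def)
  also have "\<dots> < ?P (1 / 2)"
  proof -
    have "x / 2 < x" if "x > 0" for x :: real using that by simp
    then show ?thesis using \<open>?P (1 / 2) > 0\<close> .
  qed
  finally have less: "?P \<beta> < ?P (1 / 2)" .
  have "connected (?P ` {0<..<1})"
    using assms by (intro connected_continuous_image continuous_intros continuous_on_flower_period) auto
  then have "{?P \<beta>..?P (1 / 2)} \<subseteq> ?P ` {0<..<1}"
    using \<beta> by (intro connected_contains_Icc) auto
  then have sub: "{?P \<beta><..<?P (1 / 2)} \<subseteq> ?P ` {0<..<1}"
    by (rule subset_trans[rotated]) (rule greaterThanLessThan_subseteq_atLeastAtMost_iff[THEN iffD2], simp)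
  have "\<rat> \<inter> {?P \<beta><..<?P (1 / 2)} \<subseteq> ?P ` ?S"
  proof
    fix r assume r: "r \<in> \<rat> \<inter> {?P \<beta><..<?P (1 / 2)}"
    then have "r \<in> ?P ` {0<..<1}" using subsetD[OF sub] by (simp only: Int_iff)
    then obtain x where "x \<in> {0<..<1}" "r = ?P x" by (rule imageE)
    with r have "x \<in> ?S" by simp
    with \<open>r = ?P x\<close> show "r \<in> ?P ` ?S" by (rule image_eqI)
  qed
  then show False
    using infinite_Rats_between[OF less] fin by (meson finite_imageI finite_subset)
qed

text \<open>Strict monotonicity: the numerator of \<open>flower_kappa\<close> increases strictly in
  \<beta>, and its denominator does not increase.\<close>

lemma inj_on_flower_kappa:
  assumes "m > 0"
  shows "inj_on (flower_kappa m) {0<..<1}"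
proof (rule linorder_inj_onI)
  fix x y :: real assume xy: "x < y" "x \<in> {0<..<1}" "y \<in> {0<..<1}"
  have "(1 + x) / (1 - x) < (1 + y) / (1 - y)" using xy by (intro frac_less) auto
  then have "sqrt ((1 + x) / (1 - x)) < sqrt ((1 + y) / (1 - y))" by simp
  then have "flower_kappa m x < flower_kappa m y"
    unfolding flower_kappa_def using xy assms recip_sum_antimono[of x y m] recip_sum_pos[of m y]
    by (intro frac_less) auto
  then show "flower_kappa m x \<noteq> flower_kappa m y" by simp
qed auto

subsection \<open>The flower curve in closed form\<close>

text \<open>Here \<open>m = n - 1\<close>, and \<open>\<beta>\<close> is the minimal height \<open>sin z\<^sub>L\<close>; \<open>A\<close> is the angular momentum
  of the unit speed curve about the axis of rotation, and \<open>(nz, nb)\<close> is its unit normal.\<close>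

locale flower =
  fixes m :: nat and \<beta> :: real and \<phi> :: "real \<Rightarrow> real"
  assumes m: "m \<ge> 2" and \<beta>: "0 < \<beta>" "\<beta> < 1"
    and \<phi>_deriv: "\<And>u. (\<phi> has_real_derivative phase_speed m \<beta> (flower_height \<beta> u)) (at u)"
begin

abbreviation X where "X \<equiv> recip_sum m"
abbreviation M where "M \<equiv> flower_M m \<beta>"
abbreviation \<kappa> where "\<kappa> \<equiv> flower_kappa m \<beta>"
abbreviation b where "b \<equiv> flower_height \<beta>"

definition \<zeta> where "\<zeta> u = sin (u / 2) * (sqrt (1 - \<beta>) * sqrt (1 + b u))"
definition A where "A u = \<kappa> * (1 - b u) * X (b u)"
text \<open>In the frame rotating with the phase, \<open>p\<close> is the radial and
  \<open>- w\<close> the angular component of the normal. Away from zeros of \<open>\<zeta>\<close>,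
  \<open>p\<close> is \<open>A * b / \<zeta>\<close>, and \<open>w\<close> is minus the arc length
  derivative of \<open>b\<close> divided by \<open>\<zeta>\<close>; both are written with the zeros
  of \<open>sin (u / 2)\<close> cancelled, hence stay smooth at the pole.\<close>

definition p where "p u = b u * \<zeta> u * \<kappa> * X (b u) / (1 + b u)"
definition w where "w u = cos (u / 2) * sqrt (M (b u)) / (X \<beta> * sqrt (1 + b u))"
definition z where "z u = of_real (\<zeta> u) * cis (\<phi> u)"
definition nz where "nz u = Complex (p u) (- w u) * cis (\<phi> u)"
definition nb where "nb u = - A u"
definition \<phi>' where "\<phi>' u = phase_speed m \<beta> (b u)"
definition b' where "b' u = - ((1 - \<beta>) * (sin (u / 2) * cos (u / 2)))"

lemmas b_bounds = flower_height_bounds[OF \<beta>]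

lemma m_pos: "m > 0" using m by simp

lemma X_pos: "X \<beta> > 0" "X (b u) > 0"
  using recip_sum_pos m_pos \<beta> b_bounds by auto

lemma M_pos: "M (b u) > 0"
  using flower_M_pos[OF m_pos] \<beta> b_bounds by auto

lemma \<kappa>_pos: "\<kappa> > 0"
  using X_pos \<beta> by (simp add: flower_kappa_def)

lemma \<kappa>_sq: "\<kappa>\<^sup>2 = (1 + \<beta>) / ((1 - \<beta>) * (X \<beta>)\<^sup>2)"
  using \<beta> by (simp add: flower_kappa_def power_divide)

text \<open>Multiplication by \<open>x - \<beta>\<close> turns \<open>recip_slope\<close> into a
  difference of reciprocal sums, which combines with their sum to a difference of squares.\<close>

lemma M_eq:
  assumes "x > 0"
  shows "(x - \<beta>) * M x = (1 + x) * (1 - \<beta>) * (X \<beta>)\<^sup>2 - (1 + \<beta>) * (1 - x) * (X x)\<^sup>2"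
proof -
  have "(x - \<beta>) * M x = 2 * (x - \<beta>) * (X \<beta>)\<^sup>2 +
      (1 + \<beta>) * (1 - x) * (X \<beta> + X x) * ((x - \<beta>) * recip_slope m \<beta> x)"
    by (simp add: flower_M_def algebra_simps)
  also have "(x - \<beta>) * recip_slope m \<beta> x = X \<beta> - X x"
    using recip_sum_diff[of \<beta> x m] assms \<beta> by simp
  also have "2 * (x - \<beta>) * (X \<beta>)\<^sup>2 + (1 + \<beta>) * (1 - x) * (X \<beta> + X x) * (X \<beta> - X x) =
      (1 + x) * (1 - \<beta>) * (X \<beta>)\<^sup>2 - (1 + \<beta>) * (1 - x) * (X x)\<^sup>2"
    by (simp add: algebra_simps power2_eq_square)
  finally show ?thesis .
qed

text \<open>Multiplied by \<open>1 - x\<close>, this is the factorization of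
  \<open>1 - x\<^sup>2 - A\<^sup>2\<close> as a function of the height \<open>x\<close>. It yields
  both the length of the normal and the sign of \<open>L\<^sup>2 - R\<^sup>2\<close>.\<close>

lemma M_\<kappa>_eq:
  assumes "x > 0"
  shows "\<kappa>\<^sup>2 * (1 - x) * (X x)\<^sup>2 + (x - \<beta>) * M x / ((1 - \<beta>) * (X \<beta>)\<^sup>2) = 1 + x"
proof -
  define D where "D = (1 - \<beta>) * (X \<beta>)\<^sup>2"
  have "D \<noteq> 0" using X_pos(1) \<beta> by (simp add: D_def)
  have "(x - \<beta>) * M x = (1 + x) * D - (1 + \<beta>) * (1 - x) * (X x)\<^sup>2"
    using M_eq[OF assms] by (simp add: D_def mult.assoc)
  then have "(x - \<beta>) * M x / D = (1 + x) - (1 + \<beta>) / D * (1 - x) * (X x)\<^sup>2"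
    using \<open>D \<noteq> 0\<close> by (simp add: diff_divide_distrib)
  then show ?thesis unfolding \<kappa>_sq D_def[symmetric] by simp
qed

section \<open>Algebraic relations between position and normal\<close>

lemma \<zeta>_sq: "(\<zeta> u)\<^sup>2 = (1 - b u) * (1 + b u)"
  using flower_height_eq(1)[of \<beta> u] b_bounds[of u] \<beta>
  by (simp add: \<zeta>_def power_mult_distrib)

lemma w_sq: "(w u)\<^sup>2 * (1 + b u) = (b u - \<beta>) * M (b u) / ((1 - \<beta>) * (X \<beta>)\<^sup>2)"
proof -
  have "(w u)\<^sup>2 * (1 + b u) = (cos (u / 2))\<^sup>2 * M (b u) / (X \<beta>)\<^sup>2"
    using b_bounds[of u] M_pos[of u] by (simp add: w_def power_mult_distrib power_divide)
  then show ?thesis using \<beta> unfolding flower_height_eq(2) by simp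
qed

lemma unit1: "(\<zeta> u)\<^sup>2 + (b u)\<^sup>2 = 1"
  unfolding \<zeta>_sq by (simp add: algebra_simps power2_eq_square)

text \<open>Multiplication by \<open>1 + b u\<close> clears the denominators. Then \<open>p\<close>
  and \<open>A\<close> contribute the shares \<open>b\<^sup>2\<close> and
  \<open>1 - b\<^sup>2\<close> of the first summand in \<open>M_\<kappa>_eq\<close>, and
  \<open>w\<close> contributes the second summand.\<close>

lemma unit2: "(p u)\<^sup>2 + (w u)\<^sup>2 + (A u)\<^sup>2 = 1"
proof -
  let ?b = "b u"
  have b: "1 + ?b > 0" using b_bounds[of u] by simp
  have "(p u)\<^sup>2 * (1 + ?b) = ?b\<^sup>2 * \<kappa>\<^sup>2 * (X ?b)\<^sup>2 * ((\<zeta> u)\<^sup>2 / (1 + ?b))"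
    using b by (simp add: p_def power_divide power_mult_distrib power2_eq_square)
  also have "(\<zeta> u)\<^sup>2 / (1 + ?b) = 1 - ?b" using b by (simp add: \<zeta>_sq)
  finally have 1: "(p u)\<^sup>2 * (1 + ?b) = ?b\<^sup>2 * \<kappa>\<^sup>2 * (X ?b)\<^sup>2 * (1 - ?b)" .
  have 2: "(A u)\<^sup>2 * (1 + ?b) = (1 - ?b\<^sup>2) * \<kappa>\<^sup>2 * (X ?b)\<^sup>2 * (1 - ?b)"
    by (simp add: A_def power_mult_distrib algebra_simps power2_eq_square)
  have "((p u)\<^sup>2 + (w u)\<^sup>2 + (A u)\<^sup>2) * (1 + ?b) = 1 + ?b"
    unfolding distrib_right 1 2 w_sq using M_\<kappa>_eq[OF b_bounds(3)[of u]] by (simp add: algebra_simps)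
  then show ?thesis using b by simp
qed

lemma orth1: "p u * \<zeta> u = A u * b u"
proof -
  have "p u * \<zeta> u = b u * \<kappa> * X (b u) * ((\<zeta> u)\<^sup>2 / (1 + b u))"
    by (simp add: p_def power2_eq_square)
  also have "(\<zeta> u)\<^sup>2 / (1 + b u) = 1 - b u" using b_bounds[of u] by (simp add: \<zeta>_sq)
  finally show ?thesis by (simp add: A_def)
qed

section \<open>Smoothness and derivatives of the curve and its normal\<close>

lemma b_deriv: "(b has_real_derivative b' u) (at u)"
proof -
  have "sin u = 2 * sin (u / 2) * cos (u / 2)" using sin_double[of "u / 2"] by simp
  then show ?thesis
    unfolding flower_height_def b'_def by (auto intro!: derivative_eq_intros simp: field_simps)
qed

lemma smooth_b: "smooth_on UNIV b"
  unfolding flower_height_def by (intro smooth_on_intros open_UNIV) auto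

lemma smooth_X: "smooth_on UNIV (\<lambda>u. X (b u))"
proof -
  have "b u \<noteq> 0" for u using b_bounds(3)[of u] by simp
  then show ?thesis
    unfolding recip_sum_def by (intro smooth_on_intros smooth_b open_UNIV) auto
qed

lemma smooth_M: "smooth_on UNIV (\<lambda>u. M (b u))"
proof -
  have "b u \<noteq> 0" for u using b_bounds(3)[of u] by simp
  then show ?thesis
    unfolding flower_M_def recip_slope_def using \<beta>
    by (intro smooth_on_intros smooth_b smooth_X open_UNIV) auto
qed

lemma b1: "0 < 1 + b u" "1 + b u \<noteq> 0" using b_bounds(3)[of u] by auto

lemma smooth_\<phi>: "smooth_on UNIV \<phi>"
proof (rule smooth_on_antiderivative)
  show "smooth_on UNIV (\<lambda>u. phase_speed m \<beta> (b u))"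
    unfolding phase_speed_def
    by (intro smooth_on_intros smooth_b smooth_X smooth_M open_UNIV)
       (use b1 M_pos \<beta> less_imp_neq[OF M_pos, symmetric] in \<open>auto simp: zero_less_divide_iff\<close>)
  show "(\<phi> has_vector_derivative phase_speed m \<beta> (b u)) (at u)" for u
    using \<phi>_deriv by (simp add: has_real_derivative_iff_has_vector_derivative)
qed

lemma smooth_\<zeta>: "smooth_on UNIV \<zeta>"
  unfolding \<zeta>_def by (intro smooth_on_intros smooth_b open_UNIV) (use b1 in auto)

lemma smooth_p: "smooth_on UNIV p"
  unfolding p_def by (intro smooth_on_intros smooth_b smooth_X smooth_\<zeta> open_UNIV) (use b1 in auto)

lemma smooth_w: "smooth_on UNIV w"
  unfolding w_def using b1 M_pos X_pos(1)
  by (intro smooth_on_intros smooth_b smooth_M open_UNIV) (auto simp: less_imp_neq[symmetric])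

lemma smooth_A: "smooth_on UNIV A"
  unfolding A_def by (intro smooth_on_intros smooth_b smooth_X open_UNIV)

lemma smooth_nb: "smooth_on UNIV nb"
  unfolding nb_def by (intro smooth_on_intros smooth_A open_UNIV)

lemma smooth_z: "smooth_on UNIV z"
  unfolding z_def
  by (intro smooth_on_intros smooth_\<phi> open_UNIV
      smooth_on_bounded_linear[OF bounded_linear_of_real _ smooth_\<zeta>])

lemma smooth_nz: "smooth_on UNIV nz"
  unfolding nz_def Complex_eq
  by (intro smooth_on_intros smooth_\<phi> open_UNIV
      smooth_on_bounded_linear[OF bounded_linear_of_real _ smooth_p]
      smooth_on_bounded_linear[OF bounded_linear_of_real _ smooth_on_minus[OF _ smooth_w]])

lemma rotating_deriv:
  assumes "(x has_real_derivative x') (at u)" "(y has_real_derivative y') (at u)"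
  shows "((\<lambda>u. Complex (x u) (y u) * cis (\<phi> u)) has_vector_derivative
    Complex (x' - y u * \<phi>' u) (y' + x u * \<phi>' u) * cis (\<phi> u)) (at u)"
proof -
  have c: "((\<lambda>u. cis (\<phi> u)) has_vector_derivative \<phi>' u *\<^sub>R (\<i> * cis (\<phi> u))) (at u)"
    using \<phi>_deriv[of u] unfolding \<phi>'_def
    by (auto simp: has_vector_derivative_def has_field_derivative_def
        intro!: derivative_eq_intros)
  have x: "((\<lambda>u. of_real (x u)) has_vector_derivative (of_real x' :: complex)) (at u)"
    and y: "((\<lambda>u. of_real (y u)) has_vector_derivative (of_real y' :: complex)) (at u)"
    using assms by (auto intro!: has_vector_derivative_of_real)
  have "((\<lambda>u. (of_real (x u) + \<i> * of_real (y u)) * cis (\<phi> u)) has_vector_derivative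
     (of_real (x u) + \<i> * of_real (y u)) * (\<phi>' u *\<^sub>R (\<i> * cis (\<phi> u))) +
     (of_real x' + \<i> * of_real y') * cis (\<phi> u)) (at u)"
    by (intro has_vector_derivative_mult has_vector_derivative_add has_vector_derivative_mult_right x y c)
  then show ?thesis
    by (auto simp: Complex_eq scaleR_conv_of_real algebra_simps elim!: has_vector_derivative_eq_rhs)
qed

definition \<zeta>' where "\<zeta>' = (\<lambda>u. deriv \<zeta> u)"

lemma \<zeta>_deriv: "(\<zeta> has_real_derivative \<zeta>' u) (at u)"
  unfolding \<zeta>'_def by (rule smooth_on_deriv[OF smooth_\<zeta>])

text \<open>The differentiated form of \<open>unit1\<close>. It stands in for a closed formula of
  the derivative, which is computed only at zeros of \<open>\<zeta>\<close>, in
  \<open>regular\<close>.\<close>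

lemma \<zeta>_\<zeta>': "\<zeta> u * \<zeta>' u = - (b u * b' u)"
proof -
  have "((\<lambda>u. (\<zeta> u)\<^sup>2 + (b u)\<^sup>2) has_real_derivative 2 * \<zeta> u * \<zeta>' u + 2 * b u * b' u) (at u)"
    by (auto intro!: derivative_eq_intros \<zeta>_deriv b_deriv)
  moreover have "((\<lambda>u. (\<zeta> u)\<^sup>2 + (b u)\<^sup>2) has_real_derivative 0) (at u)"
    unfolding unit1 by simp
  ultimately show ?thesis using DERIV_unique by fastforce
qed

text \<open>Away from zeros of \<open>\<zeta>\<close> both sides are
  \<open>- (A u / (\<zeta> u)\<^sup>2) * b' u\<close>. The proof multiplies out the explicit factors
  instead, so that it never divides by \<open>\<zeta>\<close>.\<close>

lemma w_\<zeta>_\<phi>': "w u * (\<zeta> u * \<phi>' u) = - (\<kappa> * X (b u) * b' u / (1 + b u))"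
proof -
  have "w u * \<phi>' u = cos (u / 2) * X (b u) * (sqrt (M (b u)) * sqrt ((1 + \<beta>) / M (b u))) /
      (X \<beta> * sqrt (1 + b u) * (1 + b u))"
    by (simp add: w_def \<phi>'_def phase_speed_def)
  also have "sqrt (M (b u)) * sqrt ((1 + \<beta>) / M (b u)) = sqrt (1 + \<beta>)"
    using M_pos[of u] by (simp add: real_sqrt_mult[symmetric])
  finally have w\<phi>: "w u * \<phi>' u =
    cos (u / 2) * X (b u) * sqrt (1 + \<beta>) / (X \<beta> * sqrt (1 + b u) * (1 + b u))" .
  have "w u * (\<zeta> u * \<phi>' u) = (w u * \<phi>' u) * \<zeta> u" by simp
  also have "\<dots> = cos (u / 2) * X (b u) * sqrt (1 + \<beta>) * sin (u / 2) * sqrt (1 - \<beta>) / (X \<beta> * (1 + b u))"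
    unfolding w\<phi> using b1[of u] by (simp add: \<zeta>_def)
  also have "sqrt (1 + \<beta>) = \<kappa> * X \<beta> * sqrt (1 - \<beta>)"
    using X_pos(1) \<beta> by (simp add: flower_kappa_def real_sqrt_divide)
  also have "cos (u / 2) * X (b u) * (\<kappa> * X \<beta> * sqrt (1 - \<beta>)) * sin (u / 2) * sqrt (1 - \<beta>) / (X \<beta> * (1 + b u))
    = \<kappa> * X (b u) * (sqrt (1 - \<beta>) * sqrt (1 - \<beta>)) * (sin (u / 2) * cos (u / 2)) / (1 + b u)"
    using X_pos(1) by simp
  also have "sqrt (1 - \<beta>) * sqrt (1 - \<beta>) = 1 - \<beta>" using \<beta> by simp
  finally show ?thesis by (simp add: b'_def)
qed

lemma orth2: "p u * \<zeta>' u - w u * (\<zeta> u * \<phi>' u) - A u * b' u = 0"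
proof -
  have "p u * \<zeta>' u = b u * \<kappa> * X (b u) / (1 + b u) * (\<zeta> u * \<zeta>' u)"
    by (simp add: p_def)
  then have "p u * \<zeta>' u - w u * (\<zeta> u * \<phi>' u) - A u * b' u =
    \<kappa> * X (b u) * b' u * ((1 - (b u)\<^sup>2) / (1 + b u) - (1 - b u))"
    unfolding \<zeta>_\<zeta>' w_\<zeta>_\<phi>' A_def by (simp add: power2_eq_square diff_divide_distrib algebra_simps)
  also have "(1 - (b u)\<^sup>2) / (1 + b u) = 1 - b u"
    using b1[of u] by (simp add: field_simps power2_eq_square)
  finally show ?thesis by simp
qed

definition z' where "z' u = Complex (\<zeta>' u) (\<zeta> u * \<phi>' u) * cis (\<phi> u)"

lemma z_deriv: "(z has_vector_derivative z' u) (at u)"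
  using rotating_deriv[OF \<zeta>_deriv DERIV_const[of 0]]
  by (simp add: z_def[abs_def] z'_def complex_of_real_def)

text \<open>The phase has positive derivative, so the tangent can vanish only where the radius is
  zero. There the signed radius has a derivative proportional to \<open>cos (u / 2)\<close>, which
  is nonzero where \<open>sin (u / 2)\<close> vanishes.\<close>

lemma regular: "(z' u, b' u) \<noteq> 0"
proof
  assume "(z' u, b' u) = 0"
  then have "Complex (\<zeta>' u) (\<zeta> u * \<phi>' u) = 0" and b': "b' u = 0"
    by (auto simp: z'_def zero_prod_def)
  then have \<zeta>': "\<zeta>' u = 0" "\<zeta> u * \<phi>' u = 0" by (simp_all add: complex_eq_iff)
  have "\<phi>' u > 0"
    unfolding \<phi>'_def using m_pos \<beta> b_bounds by (intro phase_speed_pos) auto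
  with \<zeta>' have "\<zeta> u = 0" by simp
  then have s: "sin (u / 2) = 0" using b1[of u] \<beta> by (simp add: \<zeta>_def)
  have "(\<zeta> has_real_derivative cos (u / 2) / 2 * (sqrt (1 - \<beta>) * sqrt (1 + b u))) (at u)"
    unfolding \<zeta>_def[abs_def] using b1[of u] b_deriv[of u]
    by (auto intro!: derivative_eq_intros simp: s)
  then have "\<zeta>' u = cos (u / 2) / 2 * (sqrt (1 - \<beta>) * sqrt (1 + b u))"
    using \<zeta>_deriv DERIV_unique by blast
  with \<zeta>' b1[of u] \<beta> have "cos (u / 2) = 0" by simp
  with s show False using sin_cos_squared_add[of "u / 2"] by simp
qed

text \<open>\<open>curv\<close> is minus the curvature of the curve with respect to \<open>(nz, nb)\<close>; the formula comes from
  differentiating \<open>b ^ (m - 1) * A = \<kappa> * (1 - b ^ m)\<close>.\<close>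

definition curv where "curv u = real m * \<kappa> + real (m - 1) * (A u / b u)"

lemma recip_sum_power: "x \<noteq> 0 \<Longrightarrow> x ^ (m - 1) * ((1 - x) * X x) = 1 - x ^ m"
proof -
  assume x: "x \<noteq> 0"
  have "x ^ (m - 1) * X x = (\<Sum>j<m. x ^ (m - 1) * (1 / x) ^ j)"
    by (simp add: recip_sum_def sum_distrib_left)
  also have "\<dots> = (\<Sum>j<m. x ^ (m - Suc j))"
    using x by (intro sum.cong) (auto simp: power_divide power_diff)
  also have "\<dots> = (\<Sum>j<m. x ^ j)" by (rule sum.nat_diff_reindex)
  finally show ?thesis by (simp add: one_diff_power_eq mult.left_commute)
qed

lemma A_power: "b u ^ (m - 1) * A u = \<kappa> * (1 - b u ^ m)"
  using recip_sum_power[of "b u"] b_bounds(3)[of u] by (simp add: A_def mult.left_commute mult.assoc)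

lemma A_deriv: "(A has_real_derivative - curv u * b' u) (at u)"
proof -
  have D: "(A has_real_derivative deriv A u) (at u)" by (rule smooth_on_deriv[OF smooth_A])
  have "((\<lambda>u. b u ^ (m - 1) * A u) has_real_derivative
      b u ^ (m - 1) * deriv A u + real (m - 1) * b u ^ (m - 2) * b' u * A u) (at u)"
    by (auto intro!: derivative_eq_intros D b_deriv simp: numeral_2_eq_2)
  moreover have "((\<lambda>u. \<kappa> * (1 - b u ^ m)) has_real_derivative - (\<kappa> * (m * b u ^ (m - 1) * b' u))) (at u)"
    by (auto intro!: derivative_eq_intros b_deriv)
  ultimately have "b u ^ (m - 1) * deriv A u + real (m - 1) * b u ^ (m - 2) * b' u * A u =
      - (\<kappa> * (m * b u ^ (m - 1) * b' u))"
    unfolding A_power using DERIV_unique by blast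
  moreover have "b u ^ (m - 1) = b u ^ (m - 2) * b u"
    using m by (metis Suc_1 Suc_diff_le diff_Suc_Suc power_Suc2)
  ultimately have "b u ^ (m - 2) * (b u * deriv A u) =
      b u ^ (m - 2) * (- (\<kappa> * (m * b u * b' u)) - real (m - 1) * b' u * A u)"
    by (simp add: algebra_simps)
  then have "b u * deriv A u = - (\<kappa> * (m * b u * b' u)) - real (m - 1) * b' u * A u"
    using b_bounds(3)[of u] by simp
  then have "deriv A u = - curv u * b' u"
    using b_bounds(3)[of u] by (simp add: curv_def field_simps)
  with D show ?thesis by simp
qed

lemma nb_deriv: "(nb has_real_derivative curv u * b' u) (at u)"
  unfolding nb_def[abs_def] using A_deriv[of u] by (auto intro!: derivative_eq_intros)

text \<open>Away from the multiples of \<open>\<pi>\<close> this follows from the orthogonality relations alone, since there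
  \<open>\<zeta>\<close> and \<open>w\<close> do not vanish; continuity gives the rest.\<close>

lemma nz_deriv: "(nz has_vector_derivative curv u *\<^sub>R z' u) (at u)"
proof -
  define p' w' where "p' = deriv p" and "w' = deriv w"
  have p': "(p has_real_derivative p' u) (at u)" and w': "(w has_real_derivative w' u) (at u)" for u
    unfolding p'_def w'_def by (intro smooth_on_deriv smooth_p smooth_w)+
  define n1 n2 where "n1 u = p' u + w u * \<phi>' u" and "n2 u = p u * \<phi>' u - w' u" for u
  have nz': "(nz has_vector_derivative Complex (n1 u) (n2 u) * cis (\<phi> u)) (at u)" for u
    using rotating_deriv[OF p' DERIV_minus[OF w']] unfolding nz_def[abs_def] n1_def n2_def
    by (simp add: algebra_simps)
  have generic: "Complex (n1 u) (n2 u) * cis (\<phi> u) = curv u *\<^sub>R z' u" if "sin u \<noteq> 0" for u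
  proof -
    have "sin u = 2 * sin (u / 2) * cos (u / 2)" using sin_double[of "u / 2"] by simp
    with that have sc: "sin (u / 2) \<noteq> 0" "cos (u / 2) \<noteq> 0" by auto
    then have nz: "\<zeta> u \<noteq> 0" "w u \<noteq> 0"
      using b1[of u] M_pos[of u] X_pos(1) \<beta> by (auto simp: \<zeta>_def w_def)
    \<comment> \<open>Differentiating unit length and orthogonality to the position gives a
      triangular linear system for \<open>n1\<close> and \<open>n2\<close> with diagonal entries
      \<open>\<zeta>\<close> and \<open>w\<close>; \<open>orth2\<close> identifies its solution as
      \<open>curv\<close> times the tangent.\<close>
    have "((\<lambda>u. (p u)\<^sup>2 + (w u)\<^sup>2 + (A u)\<^sup>2) has_real_derivative
        2 * p u * p' u + 2 * w u * w' u - 2 * A u * (curv u * b' u)) (at u)"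
      by (auto intro!: derivative_eq_intros p' w' A_deriv)
    moreover have "((\<lambda>u. (p u)\<^sup>2 + (w u)\<^sup>2 + (A u)\<^sup>2) has_real_derivative 0) (at u)"
      unfolding unit2 by simp
    ultimately have e2: "p u * p' u + w u * w' u - A u * (curv u * b' u) = 0"
      using DERIV_unique by fastforce
    have "((\<lambda>u. p u * \<zeta> u - A u * b u) has_real_derivative
        p' u * \<zeta> u + p u * \<zeta>' u + curv u * b' u * b u - A u * b' u) (at u)"
      by (auto intro!: derivative_eq_intros p' \<zeta>_deriv A_deriv b_deriv)
    moreover have "((\<lambda>u. p u * \<zeta> u - A u * b u) has_real_derivative 0) (at u)"
      unfolding orth1 by simp
    ultimately have e1: "p' u * \<zeta> u + p u * \<zeta>' u + curv u * b' u * b u - A u * b' u = 0"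
      using DERIV_unique by blast
    have "\<zeta> u * n1 u = - (curv u * (b u * b' u))"
      using e1 orth2[of u] by (simp add: n1_def algebra_simps)
    also have "\<dots> = curv u * (\<zeta> u * \<zeta>' u)" by (simp add: \<zeta>_\<zeta>')
    finally have "\<zeta> u * n1 u = \<zeta> u * (curv u * \<zeta>' u)" by simp
    with nz have n1: "n1 u = curv u * \<zeta>' u" by simp
    have "p u * n1 u - w u * n2 u = A u * (curv u * b' u)"
      using e2 by (simp add: n1_def n2_def algebra_simps)
    then have "w u * n2 u = w u * (curv u * (\<zeta> u * \<phi>' u)) + curv u * (p u * \<zeta>' u - w u * (\<zeta> u * \<phi>' u) - A u * b' u)"
      unfolding n1 by (simp add: algebra_simps)
    with nz have "n2 u = curv u * (\<zeta> u * \<phi>' u)" by (simp add: orth2)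
    with n1 show ?thesis
      by (simp add: z'_def complex_eq_iff algebra_simps)
  qed
  obtain nz'' where nz'': "\<And>u. (nz has_vector_derivative nz'' u) (at u)" "smooth_on UNIV nz''"
    using smooth_on_vector_derivative[OF smooth_nz] by blast
  obtain z'' where z'': "\<And>u. (z has_vector_derivative z'' u) (at u)" "smooth_on UNIV z''"
    using smooth_on_vector_derivative[OF smooth_z] by blast
  have zz: "z'' u = z' u" for u using z''(1) z_deriv vector_derivative_unique_at by blast
  have "smooth_on UNIV curv"
    unfolding curv_def[abs_def] using b_bounds(3)
    by (intro smooth_on_intros smooth_A smooth_b open_UNIV) (auto simp: less_imp_neq[symmetric])
  then have cont: "continuous_on UNIV (\<lambda>u. nz'' u - curv u *\<^sub>R z'' u)"
    by (intro smooth_on_continuous smooth_on_intros nz'' z'' open_UNIV)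
  have "nz'' u - curv u *\<^sub>R z'' u = 0" if "sin u \<noteq> 0" for u
    using generic[OF that] vector_derivative_unique_at[OF nz' nz''(1)] zz by simp
  \<comment> \<open>Zeros of the sine are isolated, so the identity holds in a punctured
    neighbourhood of every \<open>u\<close> and passes to the limit.\<close>
  moreover have "\<forall>\<^sub>F v in at u. sin v \<noteq> 0"
  proof (cases "sin u = 0")
    case True
    then have "cos u \<noteq> 0" using sin_cos_squared_add[of u] by auto
    have "sin v \<noteq> 0" if "v \<noteq> u" "dist v u < pi" for v
    proof -
      have "sin v = sin (v - u) * cos u" using sin_add[of "v - u" u] True by simp
      moreover have "sin (v - u) \<noteq> 0"
        using sin_eq_0_pi[of "v - u"] that by (auto simp: dist_real_def abs_less_iff)
      ultimately show ?thesis using \<open>cos u \<noteq> 0\<close> by simp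
    qed
    then show ?thesis unfolding eventually_at using pi_gt_zero by blast
  next
    case False
    then show ?thesis
      by (intro tendsto_imp_eventually_ne[of sin "sin u"] tendsto_intros)
  qed
  ultimately have "\<forall>\<^sub>F v in at u. nz'' v - curv v *\<^sub>R z'' v = 0"
    by (auto elim: eventually_mono)
  then have "((\<lambda>v. nz'' v - curv v *\<^sub>R z'' v) \<longlongrightarrow> 0) (at u)"
    by (simp add: tendsto_eventually)
  moreover have "((\<lambda>v. nz'' v - curv v *\<^sub>R z'' v) \<longlongrightarrow> nz'' u - curv u *\<^sub>R z'' u) (at u)"
    using cont by (simp add: continuous_on_def)
  ultimately have "0 = nz'' u - curv u *\<^sub>R z'' u"
    by (rule tendsto_unique[rotated]) simp
  then show ?thesis using nz''(1)[of u] zz by simp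
qed

subsection \<open>Closed flower curves\<close>

lemma z_inner: "z u \<bullet> z u = (\<zeta> u)\<^sup>2"
  unfolding z_def inner_mult_cis by (simp add: inner_complex_def power2_eq_square)

lemma nz_inner_z: "nz u \<bullet> z u = A u * b u"
  unfolding z_def nz_def inner_mult_cis by (simp add: inner_complex_def orth1)

lemma A_pos: "z u \<noteq> 0 \<Longrightarrow> A u > 0"
proof -
  assume "z u \<noteq> 0"
  then have "\<zeta> u \<noteq> 0" by (auto simp: z_def)
  then have "b u \<noteq> 1" using \<zeta>_sq[of u] by auto
  then show ?thesis using b_bounds(2)[of u] X_pos(2)[of u] \<kappa>_pos by (simp add: A_def)
qed

lemma b_shift: "b (u + 2 * pi) = b u"
  by (simp add: flower_height_def)

lemma \<phi>_shift: "\<phi> (u + 2 * pi) = \<phi> u + flower_period m \<beta>"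
proof -
  have "((\<lambda>u. \<phi> (u + 2 * pi) - \<phi> u) has_real_derivative 0) (at u)" for u
    using \<phi>_deriv[of "u + 2 * pi"] \<phi>_deriv[of u]
    by (auto intro!: derivative_eq_intros DERIV_chain2[of \<phi>] simp: b_shift)
  then have "\<phi> (u + 2 * pi) - \<phi> u = \<phi> (0 + 2 * pi) - \<phi> 0"
    using DERIV_isconst_all[of "\<lambda>u. \<phi> (u + 2 * pi) - \<phi> u"] by blast
  moreover have "((\<lambda>u. phase_speed m \<beta> (b u)) has_integral \<phi> (2 * pi) - \<phi> 0) {0..2 * pi}"
    using \<phi>_deriv
    by (intro fundamental_theorem_of_calculus)
       (auto simp: has_real_derivative_iff_has_vector_derivative[symmetric]
         intro: has_field_derivative_at_within)
  ultimately show ?thesis by (simp add: flower_period_def integral_unique)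
qed

text \<open>The half angles in \<open>\<zeta>\<close> and \<open>w\<close> change sign under a shift
  by \<open>2 * pi\<close>, hence the multiples of \<open>4 * pi\<close>. Over
  \<open>4 * pi * q\<close> the phase grows by \<open>2 * q\<close> times its gain, which by
  assumption is \<open>4 * pi * i\<close>.\<close>

lemma shift:
  assumes "flower_period m \<beta> * real q = 2 * pi * of_int i"
  shows "z (u + 4 * pi * q) = z u" "b (u + 4 * pi * q) = b u"
    "nz (u + 4 * pi * q) = nz u" "nb (u + 4 * pi * q) = nb u"
proof -
  have "\<phi> (u + 2 * pi * k) = \<phi> u + flower_period m \<beta> * k" for k :: nat
  proof (induction k)
    case (Suc k)
    then show ?case using \<phi>_shift[of "u + 2 * pi * k"] by (simp add: algebra_simps)
  qed simp
  from this[of "2 * q"] have "\<phi> (u + 4 * pi * q) = \<phi> u + of_int (2 * i) * (2 * pi)"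
    using assms by (simp add: algebra_simps)
  then have c: "cis (\<phi> (u + 4 * pi * q)) = cis (\<phi> u)"
    using periodic_of_int[of cis "2 * pi" "\<phi> u" "2 * i"] by (simp add: complex_eq_iff)
  show b: "b (u + 4 * pi * q) = b u"
  proof -
    have *: "u + 4 * pi * q = u + of_int (2 * int q) * (2 * pi)" by simp
    show ?thesis unfolding * by (rule periodic_of_int[of b, OF b_shift])
  qed
  have h: "(u + 4 * pi * q) / 2 = u / 2 + of_int (int q) * (2 * pi)" by simp
  have s: "sin ((u + 4 * pi * q) / 2) = sin (u / 2)" "cos ((u + 4 * pi * q) / 2) = cos (u / 2)"
    unfolding h by (rule periodic_of_int; simp)+
  show "z (u + 4 * pi * q) = z u" "nz (u + 4 * pi * q) = nz u" "nb (u + 4 * pi * q) = nb u"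
    by (simp_all only: z_def nz_def nb_def p_def w_def A_def \<zeta>_def b s c)
qed

text \<open>The principal curvature \<open>- curv\<close> along the curve contains
  \<open>- (m - 1) * A / b\<close>, which cancels against the \<open>m - 1\<close> curvatures
  \<open>A / b\<close> in the sphere directions; \<open>- m * \<kappa>\<close> remains.\<close>

lemma cmc_flower:
  assumes "T > 0" "\<And>u. z (u + T) = z u" "\<And>u. b (u + T) = b u"
    "\<And>u. nz (u + T) = nz u" "\<And>u. nb (u + T) = nb u" and "CARD('d::finite) = m"
  shows "cmc_immersion (revolve T z b :: _ \<Rightarrow> complex \<times> (real ^ 'd)) (revolve T nz nb) (- (m * \<kappa>))"
proof (rule cmc_immersion_revolve[OF assms(1-5) smooth_z smooth_b smooth_nz smooth_nb z_deriv _ nz_deriv])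
  show "(b has_vector_derivative b' u) (at u)" for u
    using b_deriv by (simp add: has_real_derivative_iff_has_vector_derivative)
  show "(nb has_vector_derivative curv u * b' u) (at u)" for u
    using nb_deriv by (simp add: has_real_derivative_iff_has_vector_derivative)
  show "z u \<bullet> z u + b u * b u = 1" for u
    using unit1[of u] by (simp add: z_inner power2_eq_square)
  show "nz u \<bullet> nz u + nb u * nb u = 1" for u
    using unit2[of u] unfolding nz_def inner_mult_cis nb_def
    by (simp add: inner_complex_def power2_eq_square)
  show "nz u \<bullet> z u + nb u * b u = 0" for u
    by (simp add: nz_inner_z nb_def)
  show "nz u \<bullet> z' u + nb u * b' u = 0" for u
    using orth2[of u] unfolding nz_def z'_def inner_mult_cis nb_def
    by (simp add: inner_complex_def)
  show "b u > 0" for u by (rule b_bounds)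
  show "(z' u, b' u) \<noteq> 0" for u by (rule regular)
  show "- curv u - real (CARD('d) - 1) * (nb u / b u) = - (m * \<kappa>)" for u
    by (simp add: assms(6) curv_def nb_def)
qed

abbreviation c where "c u \<equiv> (z u, b u)"

lemma induced_by_flower:
  assumes "T > 0" "\<And>u. z (u + T) = z u" "\<And>u. b (u + T) = b u"
  shows "induced_by c T (revolve T z b)"
  unfolding induced_by_def generated_hypersurface_def
  by (simp add: revolve_eq[of T z b, OF assms refl])

text \<open>The angular component of the normal drops out of the inner product, and the sign of
  \<open>\<zeta>\<close> cancels between \<open>p\<close> and \<open>z\<close>. What is left is
  \<open>A\<close>, positive off the pole, times a positive number.\<close>

lemma toward_great_circle_flower:
  assumes "T > 0" "\<And>u. nz (u + T) = nz u" "\<And>u. nb (u + T) = nb u"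
  shows "toward_great_circle c T (revolve T nz nb)"
  unfolding toward_great_circle_def
proof (intro allI impI ballI)
  fix \<tau> and x :: "real ^ 'd" assume "fst (c \<tau>) \<noteq> 0" and "x \<in> sphere 0 1"
  then have z: "z \<tau> \<noteq> 0" and x: "x \<bullet> x = 1" by (auto simp: norm_eq_1)
  have "revolve T nz nb (cis (2 * pi * \<tau> / T), x) \<bullet>
      (snd (c \<tau>) *\<^sub>R sgn (fst (c \<tau>)), - norm (fst (c \<tau>)) *\<^sub>R x) =
      b \<tau> * (A \<tau> * b \<tau>) / norm (z \<tau>) + norm (z \<tau>) * A \<tau>"
    using revolve_eq[of T nz nb, OF assms refl, of \<tau> x] x
    by (simp add: sgn_div_norm nz_inner_z nb_def divide_inverse)
  also have "\<dots> > 0"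
    using z A_pos[OF z] b_bounds(3)[of \<tau>] by (intro add_pos_pos divide_pos_pos mult_pos_pos) auto
  finally show "revolve T nz nb (cis (2 * pi * \<tau> / T), x) \<bullet>
      (snd (c \<tau>) *\<^sub>R sgn (fst (c \<tau>)), - norm (fst (c \<tau>)) *\<^sub>R x) > 0" .
qed

subsection \<open>The pieces of a flower curve\<close>

abbreviation n where "n \<equiv> Suc m"
abbreviation h where "h \<equiv> m * \<kappa>"

lemma flower_L_eq: "flower_L n s = cos s * sin s ^ (m - 1)"
  using m by (simp add: flower_L_def Suc_diff_le numeral_2_eq_2)

lemma flower_R_eq:
  "flower_R n h s = \<kappa> * (1 - sin s ^ m)"
  using m by (simp add: flower_R_def)

lemma flower_R_eq':
  assumes "sin s \<noteq> 0"
  shows "flower_R n h s = \<kappa> * (sin s ^ (m - 1) * ((1 - sin s) * X (sin s)))"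
  using recip_sum_power[OF assms] by (simp add: flower_R_eq)

text \<open>With \<open>x = sin s\<close>, both squares contain
  \<open>x ^ (2 * (m - 1)) * (1 - x)\<close>; the difference of the cofactors is what
  \<open>M_\<kappa>_eq\<close> factors.\<close>

lemma flower_LR:
  assumes "sin s > 0"
  shows "(flower_L n s)\<^sup>2 - (flower_R n h s)\<^sup>2 =
    (sin s ^ (m - 1))\<^sup>2 * ((1 - sin s) * (sin s - \<beta>)) * (M (sin s) / ((1 - \<beta>) * (X \<beta>)\<^sup>2))"
proof -
  let ?x = "sin s"
  have "(flower_L n s)\<^sup>2 = (?x ^ (m - 1))\<^sup>2 * ((1 - ?x) * (1 + ?x))"
    unfolding flower_L_eq power_mult_distrib cos_squared_eq
    by (simp add: algebra_simps power2_eq_square)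
  moreover have "(flower_R n h s)\<^sup>2 = (?x ^ (m - 1))\<^sup>2 * ((1 - ?x) * (\<kappa>\<^sup>2 * (1 - ?x) * (X ?x)\<^sup>2))"
    using assms by (subst flower_R_eq') (auto simp: power_mult_distrib power2_eq_square)
  ultimately have "(flower_L n s)\<^sup>2 - (flower_R n h s)\<^sup>2 =
    (?x ^ (m - 1))\<^sup>2 * ((1 - ?x) * ((1 + ?x) - \<kappa>\<^sup>2 * (1 - ?x) * (X ?x)\<^sup>2))"
    by (simp add: right_diff_distrib)
  also have "(1 + ?x) - \<kappa>\<^sup>2 * (1 - ?x) * (X ?x)\<^sup>2 = (?x - \<beta>) * M ?x / ((1 - \<beta>) * (X \<beta>)\<^sup>2)"
    using M_\<kappa>_eq[OF assms] by simp
  finally show ?thesis by simp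
qed

text \<open>Both functions are nonnegative, so their squares may be compared, and in
  \<open>flower_LR\<close> only the factor \<open>sin s - \<beta>\<close> can change sign. This
  justifies reading \<beta> as the minimal height for \<open>h = m * \<kappa>\<close>.\<close>

lemma flower_dom_eq: "flower_dom n h = {arcsin \<beta><..<pi / 2}"
proof -
  have "s \<in> flower_dom n h \<longleftrightarrow> s \<in> {arcsin \<beta><..<pi / 2}" if s: "0 < s" "s < pi / 2" for s
  proof -
    let ?x = "sin s"
    have x: "0 < ?x" "?x < 1"
      using s sin_gt_zero2[of s] sin_monotone_2pi[of s "pi / 2"] by auto
    have cs: "cos s > 0" using s by (intro cos_gt_zero) auto
    have "flower_L n s \<ge> 0" "flower_R n h s \<ge> 0"
      using x cs \<kappa>_pos by (auto simp: flower_L_eq flower_R_eq power_le_one)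
    then have "flower_R n h s < flower_L n s \<longleftrightarrow> (flower_L n s)\<^sup>2 - (flower_R n h s)\<^sup>2 > 0"
      by (auto intro: power_strict_mono power2_less_imp_less)
    also have "\<dots> \<longleftrightarrow> ?x > \<beta>"
    proof -
      have "M ?x > 0" using flower_M_pos[OF m_pos \<beta>(1) x(1)] x by simp
      then have "M ?x / ((1 - \<beta>) * (X \<beta>)\<^sup>2) > 0" using \<beta> X_pos by simp
      moreover have "(?x ^ (m - 1))\<^sup>2 > 0" "1 - ?x > 0" using x by auto
      moreover have "r * (y * t) * e > 0 \<longleftrightarrow> t > 0" if "e > 0" "r > 0" "y > 0" for r y t e :: real
        using that by (simp add: zero_less_mult_iff)
      ultimately have "(flower_L n s)\<^sup>2 - (flower_R n h s)\<^sup>2 > 0 \<longleftrightarrow> ?x - \<beta> > 0"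
        unfolding flower_LR[OF x(1)] by blast
      then show ?thesis by simp
    qed
    also have "\<dots> \<longleftrightarrow> arcsin ?x > arcsin \<beta>"
      using x \<beta> by (intro arcsin_less_mono[symmetric]) auto
    also have "arcsin ?x = s" using s by (intro arcsin_sin) auto
    finally show ?thesis using s by (simp add: flower_dom_def)
  qed
  moreover have "arcsin \<beta> > 0"
    using arcsin_less_arcsin[of 0 \<beta>] \<beta> by simp
  ultimately show ?thesis by (auto simp: flower_dom_def)
qed

lemma arcsin_\<beta>: "0 < arcsin \<beta>" "arcsin \<beta> < pi / 2"
  using arcsin_less_arcsin[of 0 \<beta>] arcsin_lt_bounded[of \<beta>] \<beta> by auto

lemma flower_zL_eq: "flower_zL n h = arcsin \<beta>"
  unfolding flower_zL_def flower_dom_eq using arcsin_\<beta> by (intro cInf_greaterThanLessThan) auto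

lemma sin_dom:
  assumes "s \<in> flower_dom n h"
  shows "\<beta> < sin s" "sin s < 1" "cos s > 0"
proof -
  have s: "arcsin \<beta> < s" "s < pi / 2" using assms by (auto simp: flower_dom_eq)
  then show "cos s > 0" using arcsin_\<beta> by (intro cos_gt_zero) auto
  show "\<beta> < sin s"
    using sin_monotone_2pi[of "arcsin \<beta>" s] s arcsin_\<beta> \<beta> by simp
  show "sin s < 1" using sin_monotone_2pi[of s "pi / 2"] s arcsin_\<beta> by simp
qed

text \<open>The inverse of \<open>u \<mapsto> arcsin (b u)\<close> on \<open>(0, \<pi>)\<close>.\<close>

definition U where "U s = arccos ((2 * sin s - 1 - \<beta>) / (1 - \<beta>))"

lemma U_arg:
  assumes "s \<in> flower_dom n h"
  shows "- 1 < (2 * sin s - 1 - \<beta>) / (1 - \<beta>)" "(2 * sin s - 1 - \<beta>) / (1 - \<beta>) < 1"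
  using sin_dom[OF assms] \<beta> by (auto simp: field_simps)

lemma U_bounds:
  assumes "s \<in> flower_dom n h"
  shows "0 < U s" "U s < pi"
  using arccos_lt_bounded[OF U_arg[OF assms]] by (auto simp: U_def)

lemma b_U:
  assumes "s \<in> flower_dom n h"
  shows "b (U s) = sin s"
  using U_arg[OF assms] \<beta> by (simp add: flower_height_def U_def field_simps)

lemma b_strict:
  assumes "0 \<le> v" "v < v'" "v' \<le> pi"
  shows "b v' < b v"
  using cos_monotone_0_pi[OF assms] \<beta> by (simp add: flower_height_def)

lemma arcsin_b:
  assumes "0 < v" "v < pi"
  shows "arcsin (b v) \<in> flower_dom n h" "U (arcsin (b v)) = v"
proof -
  have "\<beta> < b v" "b v < 1"
  proof -
    have "b pi = \<beta>" "b 0 = 1" by (simp_all add: flower_height_def field_simps)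
    then show "\<beta> < b v" "b v < 1" using b_strict[of v pi] b_strict[of 0 v] assms by auto
  qed
  then show "arcsin (b v) \<in> flower_dom n h"
    unfolding flower_dom_eq using \<beta> arcsin_less_arcsin[of \<beta> "b v"] arcsin_lt_bounded[of "b v"] by auto
  have "sin (arcsin (b v)) = b v" using \<open>\<beta> < b v\<close> \<open>b v < 1\<close> \<beta> by (intro sin_arcsin) auto
  moreover have "(2 * b v - 1 - \<beta>) / (1 - \<beta>) = cos v"
    using \<beta> by (simp add: flower_height_def field_simps)
  ultimately show "U (arcsin (b v)) = v" using assms by (simp add: U_def arccos_cos)
qed

lemma U_tendsto:
  "(U \<longlongrightarrow> 0) (at_left (pi / 2))" "(U \<longlongrightarrow> pi) (at_right (arcsin \<beta>))"
proof -
  have "- 1 \<le> (2 * sin s - 1 - \<beta>) / (1 - \<beta>) \<and> (2 * sin s - 1 - \<beta>) / (1 - \<beta>) \<le> 1"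
    if "s \<in> {arcsin \<beta>..pi / 2}" for s
  proof -
    have "\<beta> \<le> sin s"
      using sin_monotone_2pi_le[of "arcsin \<beta>" s] that arcsin_\<beta> \<beta> by simp
    then show ?thesis using \<beta> by (simp add: field_simps)
  qed
  then have "continuous_on {arcsin \<beta>..pi / 2} U"
    unfolding U_def[abs_def] using \<beta> by (intro continuous_intros) auto
  then have "(U \<longlongrightarrow> U (pi / 2)) (at (pi / 2) within {arcsin \<beta>..pi / 2})"
    "(U \<longlongrightarrow> U (arcsin \<beta>)) (at (arcsin \<beta>) within {arcsin \<beta>..pi / 2})"
    using arcsin_\<beta> by (auto simp: continuous_on_def)
  moreover have "U (pi / 2) = 0" "U (arcsin \<beta>) = pi"
  proof -
    have "(2 * sin (pi / 2) - 1 - \<beta>) / (1 - \<beta>) = 1" "(2 * \<beta> - 1 - \<beta>) / (1 - \<beta>) = - 1"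
      using \<beta> by (auto simp: field_simps)
    then show "U (pi / 2) = 0" "U (arcsin \<beta>) = pi" using \<beta> by (simp_all add: U_def)
  qed
  ultimately show "(U \<longlongrightarrow> 0) (at_left (pi / 2))" "(U \<longlongrightarrow> pi) (at_right (arcsin \<beta>))"
    using arcsin_\<beta> by (simp_all add: at_within_Icc_at_left at_within_Icc_at_right)
qed

lemma U_deriv:
  assumes "s \<in> flower_dom n h"
  shows "(U has_real_derivative - (cos s / sqrt ((1 - sin s) * (sin s - \<beta>)))) (at s)"
proof -
  let ?y = "(2 * sin s - 1 - \<beta>) / (1 - \<beta>)"
  have "1 - ?y\<^sup>2 = (1 - ?y) * (1 + ?y)" by (simp add: algebra_simps power2_eq_square)
  also have "1 - ?y = 2 * (1 - sin s) / (1 - \<beta>)" using \<beta> by (simp add: field_simps)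
  also have "1 + ?y = 2 * (sin s - \<beta>) / (1 - \<beta>)" using \<beta> by (simp add: field_simps)
  also have "2 * (1 - sin s) / (1 - \<beta>) * (2 * (sin s - \<beta>) / (1 - \<beta>)) =
      (2 / (1 - \<beta>))\<^sup>2 * ((1 - sin s) * (sin s - \<beta>))"
    by (simp add: power2_eq_square) (simp add: algebra_simps)
  finally have "sqrt (1 - ?y\<^sup>2) = 2 / (1 - \<beta>) * sqrt ((1 - sin s) * (sin s - \<beta>))"
    using \<beta> by (simp add: real_sqrt_mult)
  then have eq: "inverse (- sqrt (1 - ?y\<^sup>2)) * (2 * cos s / (1 - \<beta>)) =
      - (cos s / sqrt ((1 - sin s) * (sin s - \<beta>)))"
    using \<beta> sin_dom[OF assms] by simp
  have "((\<lambda>s. (2 * sin s - 1 - \<beta>) / (1 - \<beta>)) has_real_derivative 2 * cos s / (1 - \<beta>)) (at s)"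
    using \<beta> by (auto intro!: derivative_eq_intros)
  from DERIV_chain2[where f = arccos, OF DERIV_arccos[OF U_arg[OF assms]] this]
  show ?thesis unfolding eq U_def[abs_def] .
qed

text \<open>Piece \<open>k\<close> occupies the parameters between \<open>(k - 1) * pi\<close> and
  \<open>k * pi\<close>, and \<open>v\<close> is the distance from the endpoint that is an even
  multiple of \<open>pi\<close>, where the curve passes through the pole.\<close>

definition pos :: "int \<Rightarrow> real \<Rightarrow> real" where
  "pos k v = (if even k then of_int k * pi - v else of_int (k - 1) * pi + v)"

definition P :: "int \<Rightarrow> real \<Rightarrow> complex \<times> real" where
  "P k s = c (pos k (U s))"

text \<open>Parameter distance to \<open>k * pi\<close>, where pieces \<open>k\<close> and
  \<open>k + 1\<close> meet. Measured from there, the two pieces are mirror images, which is the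
  content of \<open>pos_off\<close>.\<close>

definition off :: "int \<Rightarrow> real \<Rightarrow> real" where
  "off k s = (if even k then U s else pi - U s)"

lemma pos_off: "pos k (U s) = of_int k * pi - off k s" "pos (k + 1) (U s) = of_int k * pi + off k s"
  by (auto simp: pos_def off_def algebra_simps)

lemma b_reflect: "b (of_int k * pi + v) = b (of_int k * pi - v)"
  using sin_cos_int_pi(2)[of k v] sin_cos_int_pi(2)[of k "- v"] by (simp add: flower_height_def)

lemma b_pos: "b (pos k v) = b v"
  using sin_cos_int_pi(2)[of k "- v"] sin_cos_int_pi(2)[of "k - 1" v]
  by (auto simp: pos_def flower_height_def)

text \<open>The derivative of \<open>\<phi>\<close> is even about \<open>k * pi\<close> because
  \<open>b\<close> is, so the sum of \<open>\<phi>\<close> at two mirrored points is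
  constant.\<close>

lemma \<phi>_reflect: "\<phi> (of_int k * pi + v) = 2 * \<phi> (of_int k * pi) - \<phi> (of_int k * pi - v)"
proof -
  let ?f = "\<lambda>v. \<phi> (of_int k * pi + v) + \<phi> (of_int k * pi - v)"
  have "(?f has_real_derivative 0) (at v)" for v
    using \<phi>_deriv[of "of_int k * pi + v"] \<phi>_deriv[of "of_int k * pi - v"]
    by (auto intro!: derivative_eq_intros DERIV_chain2[of \<phi>] simp: b_reflect)
  then have "?f v = ?f 0" using DERIV_isconst_all[of ?f] by blast
  then show ?thesis by simp
qed

text \<open>The sign of \<open>\<zeta>\<close> on \<open>((k - 1) \<pi>, k \<pi>)\<close>.\<close>

definition sg :: "int \<Rightarrow> real" where
  "sg k = (if even k then -1 else 1) * (if even (k div 2) then 1 else -1)"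

lemma sin_half:
  assumes "v = (if even k then x else pi - x)"
  shows "sin ((of_int k * pi - v) / 2) = sg k * sin (x / 2)"
proof -
  have "even k \<or> odd k" by simp
  then show ?thesis
  proof
    assume k: "even k"
    then have "real_of_int k = 2 * of_int (k div 2)"
      by (metis dvd_mult_div_cancel of_int_mult of_int_numeral)
    then have *: "(of_int k * pi - v) / 2 = of_int (k div 2) * pi + - (x / 2)"
      using assms k by (simp add: field_simps)
    show ?thesis unfolding * sin_cos_int_pi using k by (simp add: sg_def)
  next
    assume k: "odd k"
    then have "k = 2 * (k div 2) + 1" by (metis odd_two_times_div_two_succ)
    then have "real_of_int k = 2 * of_int (k div 2) + 1"
      by (metis of_int_1 of_int_add of_int_mult of_int_numeral)
    then have *: "(of_int k * pi - v) / 2 = of_int (k div 2) * pi + x / 2"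
      using assms k by (simp add: field_simps)
    show ?thesis unfolding * sin_cos_int_pi using k by (simp add: sg_def)
  qed
qed

text \<open>The value is known up to sign from \<open>\<zeta>_sq\<close> with
  \<open>b = sin s\<close>. The sign is isolated by \<open>sin_half\<close>, and the remaining
  factors are nonnegative.\<close>

lemma \<zeta>_pos:
  assumes "s \<in> flower_dom n h"
  shows "\<zeta> (of_int k * pi - off k s) = sg k * cos s"
proof -
  let ?u = "of_int k * pi - off k s"
  have s2: "sin (?u / 2) = sg k * sin (U s / 2)"
    by (rule sin_half) (simp add: off_def)
  have bu: "b ?u = sin s" using b_pos[of k "U s"] b_U[OF assms] by (simp add: pos_off)
  have "sin (U s / 2) > 0" using U_bounds[OF assms] by (intro sin_gt_zero) auto
  have sg: "sg k * sg k = 1" "sg k * (sg k * x) = x" for x by (auto simp: sg_def)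
  have "(sin (U s / 2) * (sqrt (1 - \<beta>) * sqrt (1 + b ?u)))\<^sup>2 = (\<zeta> ?u)\<^sup>2"
    unfolding \<zeta>_def s2 power2_eq_square using sg by (simp add: mult_ac)
  also have "\<dots> = (cos s)\<^sup>2"
    unfolding \<zeta>_sq bu cos_squared_eq by (simp add: algebra_simps power2_eq_square)
  finally have sq: "(sin (U s / 2) * (sqrt (1 - \<beta>) * sqrt (1 + b ?u)))\<^sup>2 = (cos s)\<^sup>2" .
  have "0 \<le> sin (U s / 2) * (sqrt (1 - \<beta>) * sqrt (1 + b ?u))"
    using \<open>sin (U s / 2) > 0\<close> \<beta> less_imp_le[OF b1(1)]
    by (intro mult_nonneg_nonneg real_sqrt_ge_zero) auto
  with sq have "sin (U s / 2) * (sqrt (1 - \<beta>) * sqrt (1 + b ?u)) = cos s"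
    by (rule power2_eq_imp_eq) (rule less_imp_le[OF sin_dom(3)[OF assms]])
  then show ?thesis unfolding \<zeta>_def s2 by (simp add: mult.assoc)
qed

lemma local_piece: "flower_local_piece n h (P 0)"
  unfolding flower_local_piece_def
proof (intro exI ballI conjI)
  fix s assume s: "s \<in> flower_dom n h"
  let ?x = "sin s"
  have x: "\<beta> < ?x" "?x < 1" "cos s > 0" "0 < ?x" using sin_dom[OF s] \<beta> by auto
  have bU: "b (- U s) = ?x" using b_U[OF s] by (simp add: flower_height_def)
  \<comment> \<open>Piece 0 has parameters in \<open>(- pi, 0)\<close>, where \<open>\<zeta>\<close>
    is negative; the summand \<open>pi\<close> in the phase turns the signed radius into the modulus
    \<open>cos s\<close>.\<close>
  show "P 0 s = (of_real (cos s) * cis (\<phi> (- U s) + pi), ?x)"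
  proof -
    have "cis (\<phi> (- U s) + pi) = - cis (\<phi> (- U s))" by (simp add: complex_eq_iff)
    moreover have "\<zeta> (- U s) = - cos s" using \<zeta>_pos[OF s, of 0] by (simp add: off_def sg_def)
    ultimately show ?thesis using bU by (simp add: P_def pos_def z_def)
  qed
  have "((\<lambda>s. \<phi> (- U s) + pi) has_real_derivative
      phase_speed m \<beta> (b (- U s)) * (cos s / sqrt ((1 - ?x) * (?x - \<beta>)))) (at s)"
    using DERIV_add[OF DERIV_chain2[where f = \<phi> and g = "\<lambda>s. - U s" and x = s,
        OF \<phi>_deriv DERIV_minus[OF U_deriv[OF s]]] DERIV_const[of pi]] by simp
  moreover have "phase_speed m \<beta> (b (- U s)) * (cos s / sqrt ((1 - ?x) * (?x - \<beta>))) =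
     flower_R n h s / (cos s * sqrt ((flower_L n s)\<^sup>2 - (flower_R n h s)\<^sup>2))"
  proof -
    define q where "q = sqrt ((1 - ?x) * (?x - \<beta>))"
    define y where "y = ?x ^ (m - 1)"
    have q: "q > 0" using x by (simp add: q_def)
    have y: "y > 0" using x by (simp add: y_def)
    have Mx: "M ?x > 0" using flower_M_pos[OF m_pos \<beta>(1) x(4)] x(2) by simp
    have sq: "sqrt ((flower_L n s)\<^sup>2 - (flower_R n h s)\<^sup>2) =
        y * q * (sqrt (M ?x) / (sqrt (1 - \<beta>) * X \<beta>))"
      unfolding flower_LR[OF x(4)] using y X_pos(1)
      by (simp add: real_sqrt_mult real_sqrt_divide q_def y_def)
    have "\<kappa> = sqrt (1 + \<beta>) / (sqrt (1 - \<beta>) * X \<beta>)"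
      by (simp add: flower_kappa_def real_sqrt_divide)
    then have "flower_R n h s / (cos s * sqrt ((flower_L n s)\<^sup>2 - (flower_R n h s)\<^sup>2)) =
        (sqrt (1 + \<beta>) / (sqrt (1 - \<beta>) * X \<beta>)) * (y * ((1 - ?x) * X ?x)) /
        (cos s * (y * q * (sqrt (M ?x) / (sqrt (1 - \<beta>) * X \<beta>))))"
      unfolding sq using x flower_R_eq'[of s] by (simp add: y_def)
    also have "\<dots> = sqrt (1 + \<beta>) * X ?x / (q * sqrt (M ?x)) * ((1 - ?x) / cos s)"
      using y q X_pos(1) \<beta> x by (simp add: mult_ac)
    also have "(1 - ?x) / cos s = cos s / (1 + ?x)"
    proof -
      have "(1 - ?x) * (1 + ?x) = cos s * cos s"
        using cos_squared_eq[of s] by (simp add: algebra_simps power2_eq_square)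
      then show ?thesis using x by (simp add: frac_eq_eq)
    qed
    also have "sqrt (1 + \<beta>) * X ?x / (q * sqrt (M ?x)) * (cos s / (1 + ?x)) =
      phase_speed m \<beta> ?x * (cos s / q)"
      by (simp add: phase_speed_def real_sqrt_divide mult_ac)
    finally show ?thesis unfolding bU q_def by simp
  qed
  ultimately show "((\<lambda>s. \<phi> (- U s) + pi) has_real_derivative
     flower_R n h s / (cos s * sqrt ((flower_L n s)\<^sup>2 - (flower_R n h s)\<^sup>2))) (at s)"
    by simp
qed

text \<open>Along piece \<open>k\<close> the direction of \<open>z\<close> is the sign
  \<open>sg k\<close> times \<open>cis\<close> of the phase, so the limiting phase is
  \<open>\<phi> (k * pi)\<close>, possibly increased by \<open>pi\<close>. Doubling the angle
  removes this ambiguity, and the reflections depend only on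
  \<open>cis (2 * \<theta>)\<close>.\<close>

lemma limiting_phase_P:
  assumes "(off k \<longlongrightarrow> 0) F" "\<forall>\<^sub>F s in F. s \<in> flower_dom n h"
  obtains \<theta> where "limiting_phase (P k) F \<theta>" "cis (2 * \<theta>) = cis (2 * \<phi> (of_int k * pi))"
proof
  define \<theta> where "\<theta> = \<phi> (of_int k * pi) + (if sg k = 1 then 0 else pi)"
  have sg: "sg k = 1 \<or> sg k = -1" by (auto simp: sg_def)
  then have cis: "cis \<theta> = of_real (sg k) * cis (\<phi> (of_int k * pi))"
    by (auto simp: \<theta>_def cis_mult[symmetric])
  have "cis (2 * \<theta>) = cis \<theta> * cis \<theta>" by (simp add: cis_mult)
  also have "\<dots> = cis (2 * \<phi> (of_int k * pi))" using sg by (auto simp: cis cis_mult)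
  finally show "cis (2 * \<theta>) = cis (2 * \<phi> (of_int k * pi))" .
  have eq: "of_real (sg k) * cis (\<phi> (of_int k * pi - off k s)) = sgn (fst (P k s))"
    if "s \<in> flower_dom n h" for s
    using \<zeta>_pos[OF that, of k] sin_dom(3)[OF that] sg
    by (auto simp: P_def pos_off z_def sgn_mult sgn_of_real cis.sel sgn_cis)
  have "isCont \<phi> (of_int k * pi)" using \<phi>_deriv DERIV_isCont by blast
  moreover have "((\<lambda>s. of_int k * pi - off k s) \<longlongrightarrow> of_int k * pi - 0) F"
    by (intro tendsto_intros assms(1))
  ultimately have "((\<lambda>s. \<phi> (of_int k * pi - off k s)) \<longlongrightarrow> \<phi> (of_int k * pi)) F"
    by (intro isCont_tendsto_compose[of _ \<phi>]) auto
  then have "((\<lambda>s. of_real (sg k) * cis (\<phi> (of_int k * pi - off k s))) \<longlongrightarrow> cis \<theta>) F"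
    unfolding cis by (intro tendsto_intros)
  then show "limiting_phase (P k) F \<theta>"
    unfolding limiting_phase_def
    by (rule Lim_transform_eventually) (use assms(2) eq in \<open>auto elim!: eventually_mono\<close>)
qed

text \<open>Reflection about \<open>k * pi\<close> preserves \<open>b\<close>, replaces the phase by
  \<open>2 * \<phi> (k * pi)\<close> minus itself, and acts on the sign of \<open>\<zeta>\<close>.
  As \<open>sin (u / 2)\<close> is odd about even and even about odd multiples of \<open>pi\<close>,
  the minus sign occurs exactly at the pole, as in \<open>continuation_at_p\<close>.\<close>

lemma P_Suc:
  assumes "s \<in> flower_dom n h"
  shows "P (k + 1) s = (of_real (if even k then -1 else 1) * cis (2 * \<phi> (of_int k * pi)) * cnj (fst (P k s)),
    snd (P k s))"
proof -
  let ?u = "of_int k * pi - off k s" and ?v = "of_int k * pi + off k s"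
  have bb: "b ?v = b ?u" by (rule b_reflect)
  have "sin (?v / 2) = (if even k then - sin (?u / 2) else sin (?u / 2))"
  proof (cases "even k")
    case True
    then obtain j where j: "k = 2 * j" by blast
    have "?v / 2 = of_int j * pi + off k s / 2" "?u / 2 = of_int j * pi + - (off k s / 2)"
      using j by (simp_all add: field_simps)
    then show ?thesis using True by (simp only: sin_cos_int_pi) simp
  next
    case False
    then obtain j where j: "k = 2 * j + 1" using oddE by blast
    have "?v / 2 = of_int j * pi + (off k s / 2 + pi / 2)" "?u / 2 = of_int j * pi + (pi / 2 - off k s / 2)"
      using j by (simp_all add: field_simps)
    then show ?thesis using False by (simp only: sin_cos_int_pi) (simp add: sin_add sin_diff)
  qed
  then have "\<zeta> ?v = (if even k then -1 else 1) * \<zeta> ?u" by (simp add: \<zeta>_def bb)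
  moreover have "cis (\<phi> ?v) = cis (2 * \<phi> (of_int k * pi)) * cnj (cis (\<phi> ?u))"
    unfolding \<phi>_reflect cis_cnj cis_mult by simp
  moreover have "P k s = c ?u" by (simp only: P_def pos_off(1))
  moreover have "P (k + 1) s = c ?v" by (simp only: P_def pos_off(2))
  ultimately show ?thesis using bb by (simp add: z_def)
qed

lemma pieces: "flower_pieces n h P"
  unfolding flower_pieces_def
proof (intro conjI allI local_piece)
  fix k
  show "if even k then continuation_at_p n h (P k) (P (k + 1))
    else continuation_at_zL n h (P k) (P (k + 1))"
  proof (cases "even k")
    case True
    have "\<forall>\<^sub>F s in at_left (pi / 2). s \<in> flower_dom n h"
      unfolding flower_dom_eq using arcsin_\<beta> by (intro eventually_at_left_real)
    moreover have "(off k \<longlongrightarrow> 0) (at_left (pi / 2))"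
      using U_tendsto(1) True by (simp add: off_def[abs_def])
    ultimately obtain \<theta> where "limiting_phase (P k) (at_left (pi / 2)) \<theta>"
      "cis (2 * \<theta>) = cis (2 * \<phi> (of_int k * pi))" using limiting_phase_P by blast
    then show ?thesis using True P_Suc[of _ k] by (auto simp: continuation_at_p_def)
  next
    case False
    have "\<forall>\<^sub>F s in at_right (arcsin \<beta>). s \<in> flower_dom n h"
      unfolding flower_dom_eq using arcsin_\<beta> by (intro eventually_at_right_real)
    moreover have "(off k \<longlongrightarrow> 0) (at_right (arcsin \<beta>))"
      using tendsto_diff[OF tendsto_const[of pi] U_tendsto(2)] False by (simp add: off_def[abs_def])
    ultimately obtain \<theta> where "limiting_phase (P k) (at_right (arcsin \<beta>)) \<theta>"
      "cis (2 * \<theta>) = cis (2 * \<phi> (of_int k * pi))" using limiting_phase_P by blast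
    then show ?thesis using False P_Suc[of _ k] by (auto simp: continuation_at_zL_def flower_zL_eq)
  qed
qed

section \<open>Assembly of the pieces into the complete curve\<close>

lemma pos_interval:
  assumes "\<tau> \<in> {of_int (k - 1) * pi<..<of_int k * pi}"
  obtains v where "0 < v" "v < pi" "\<tau> = pos k v"
proof (cases "even k")
  case True
  show ?thesis
    by (rule that[of "of_int k * pi - \<tau>"]) (use assms True in \<open>auto simp: pos_def algebra_simps\<close>)
next
  case False
  show ?thesis
    by (rule that[of "\<tau> - of_int (k - 1) * pi"]) (use assms False in \<open>auto simp: pos_def algebra_simps\<close>)
qed

lemma pos_in_interval:
  "0 < v \<Longrightarrow> v < pi \<Longrightarrow> pos k v \<in> {of_int (k - 1) * pi<..<of_int k * pi}"
  by (auto simp: pos_def algebra_simps)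

lemma arcsin_b_strict:
  assumes "0 < v" "v < v'" "v' < pi"
  shows "arcsin (b v') < arcsin (b v)"
  using b_strict[of v v'] assms b_bounds(2)[of v] b_bounds(3)[of v'] by (intro arcsin_less_arcsin) auto

lemma complete: "complete_flower_curve n h c"
  unfolding complete_flower_curve_def
proof (intro conjI exI allI)
  show "continuous_on UNIV c"
    by (intro continuous_on_Pair smooth_on_continuous smooth_z smooth_b)
  show "flower_pieces n h P" by (rule pieces)
  \<comment> \<open>Piece \<open>k\<close> ends at \<open>k * pi\<close>, so its left endpoint is
    \<open>(k - 1) * pi\<close>; accordingly \<open>\<tau>\<close> belongs to the piece with number
    \<open>\<lfloor>\<tau> / pi\<rfloor> + 1\<close>.\<close>
  show "strict_mono (\<lambda>k :: int. of_int (k - 1) * pi)"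
    by (auto simp: strict_mono_def)
  fix \<tau> :: real
  show "of_int (\<lfloor>\<tau> / pi\<rfloor> + 1 - 1) * pi \<le> \<tau>"
    using mult_right_mono[OF of_int_floor_le[of "\<tau> / pi"], of pi] by simp
  show "\<tau> < of_int (\<lfloor>\<tau> / pi\<rfloor> + 1 + 1 - 1) * pi"
    using mult_strict_right_mono[of "\<tau> / pi" "of_int \<lfloor>\<tau> / pi\<rfloor> + 1" pi] floor_correct[of "\<tau> / pi"] by (simp add: add.commute)
next
  fix k :: int
  let ?I = "{of_int (k - 1) * pi<..<of_int (k + 1 - 1) * pi}"
  have I: "?I = {of_int (k - 1) * pi<..<of_int k * pi}" by simp
  have b_pos': "arcsin (b (pos k v)) = arcsin (b v)" for v by (simp add: b_pos)
  show "(\<lambda>\<tau>. arcsin (b \<tau>)) ` ?I = flower_dom n h"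
  proof
    show "(\<lambda>\<tau>. arcsin (b \<tau>)) ` ?I \<subseteq> flower_dom n h"
      unfolding I
    proof (rule image_subsetI)
      fix \<tau> assume "\<tau> \<in> {of_int (k - 1) * pi<..<of_int k * pi}"
      then obtain v where "0 < v" "v < pi" "\<tau> = pos k v" by (rule pos_interval)
      then show "arcsin (b \<tau>) \<in> flower_dom n h" using arcsin_b(1) by (simp add: b_pos')
    qed
    show "flower_dom n h \<subseteq> (\<lambda>\<tau>. arcsin (b \<tau>)) ` ?I"
    proof
      fix s assume s: "s \<in> flower_dom n h"
      have "arcsin (b (pos k (U s))) = s"
        using b_U[OF s] s arcsin_\<beta> by (simp add: b_pos' flower_dom_eq arcsin_sin)
      then show "s \<in> (\<lambda>\<tau>. arcsin (b \<tau>)) ` ?I"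
        unfolding I using pos_in_interval[OF U_bounds[OF s]] by (metis imageI)
    qed
  qed
  show "if even k then strict_mono_on ?I (\<lambda>\<tau>. arcsin (b \<tau>))
    else strict_antimono_on ?I (\<lambda>\<tau>. arcsin (b \<tau>))"
  proof (cases "even k")
    case True
    have "arcsin (b \<tau>) < arcsin (b \<tau>')" if \<tau>: "\<tau> \<in> ?I" "\<tau>' \<in> ?I" "\<tau> < \<tau>'" for \<tau> \<tau>'
    proof -
      obtain v v' where v: "0 < v" "v < pi" "\<tau> = pos k v" "0 < v'" "v' < pi" "\<tau>' = pos k v'"
        using \<tau>(1,2) unfolding I by (elim pos_interval)
      moreover from this \<tau>(3) True have "v' < v" by (simp add: pos_def)
      ultimately show ?thesis using arcsin_b_strict[of v' v] by (simp add: b_pos')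
    qed
    then show ?thesis using True by (auto intro: strict_mono_onI)
  next
    case False
    have "arcsin (b \<tau>') < arcsin (b \<tau>)" if \<tau>: "\<tau> \<in> ?I" "\<tau>' \<in> ?I" "\<tau> < \<tau>'" for \<tau> \<tau>'
    proof -
      obtain v v' where v: "0 < v" "v < pi" "\<tau> = pos k v" "0 < v'" "v' < pi" "\<tau>' = pos k v'"
        using \<tau>(1,2) unfolding I by (elim pos_interval)
      moreover from this \<tau>(3) False have "v < v'" by (simp add: pos_def)
      ultimately show ?thesis using arcsin_b_strict[of v v'] by (simp add: b_pos')
    qed
    then show ?thesis using False by (auto intro!: monotone_onI)
  qed
  show "\<forall>\<tau> \<in> ?I. c \<tau> = P k (arcsin (b \<tau>))"
  proof
    fix \<tau> assume "\<tau> \<in> ?I"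
    then obtain v where v: "0 < v" "v < pi" "\<tau> = pos k v" unfolding I by (rule pos_interval)
    then show "c \<tau> = P k (arcsin (b \<tau>))"
      using arcsin_b(2)[OF v(1,2)] by (simp add: P_def b_pos')
  qed
qed

lemma closed_flower:
  assumes "flower_period m \<beta> / (2 * pi) \<in> \<rat>" and "CARD('d::finite) = m"
  shows "\<exists>c T. complete_flower_curve n h c \<and> closed_curve c T \<and>
      (\<exists>F N :: complex \<times> (real ^ 'd) \<Rightarrow> complex \<times> (real ^ 'd).
         induced_by c T F \<and> cmc_immersion F N (- h) \<and> toward_great_circle c T N)"
proof -
  obtain i :: int and q :: nat where q: "q \<noteq> 0" "flower_period m \<beta> / (2 * pi) = of_int i / of_nat q"
    using assms(1) unfolding Rats_eq_int_div_nat by auto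
  define T where "T = 4 * pi * q"
  have T: "T > 0" using q(1) by (simp add: T_def)
  have "flower_period m \<beta> * real q = 2 * pi * of_int i"
    using q by (simp add: field_simps)
  note per = shift[OF this, folded T_def]
  show ?thesis
    using complete T per induced_by_flower[OF T per(1,2)] cmc_flower[OF T per assms(2)]
      toward_great_circle_flower[OF T per(3,4)]
    unfolding closed_curve_def
    by (intro exI[of _ c] exI[of _ T] exI[of _ "revolve T z b"] exI[of _ "revolve T nz nb"]) auto
qed

end

text \<open>The phase speed is continuous on the whole line and so has an antiderivative there; its
  free additive constant is a rotation of the curve in the complex factor.\<close>

lemma ex_flower:
  assumes "m \<ge> 2" "0 < \<beta>" "\<beta> < 1"
  shows "\<exists>\<phi>. flower m \<beta> \<phi>"
proof -
  have "isCont (\<lambda>u. phase_speed m \<beta> (flower_height \<beta> u)) u" for u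
    using continuous_on_phase_speed_height[of m \<beta> UNIV] assms
    by (simp add: continuous_on_eq_continuous_at)
  then have "\<exists>F. \<forall>x. -\<infinity> < ereal x \<longrightarrow> ereal x < \<infinity> \<longrightarrow>
      (F has_vector_derivative phase_speed m \<beta> (flower_height \<beta> x)) (at x)"
    by (intro einterval_antiderivative) auto
  then show ?thesis
    using assms by (auto simp: flower_def has_real_derivative_iff_has_vector_derivative)
qed

theorem theorem5p7:
  fixes n :: nat
  assumes "n \<ge> 3" and "CARD('m::finite) = n - 1"
  shows "infinite {h :: real. h > 0 \<and>
    (\<exists>c T. complete_flower_curve n h c \<and> closed_curve c T \<and>
      (\<exists>F N :: complex \<times> (real ^ 'm) \<Rightarrow> complex \<times> (real ^ 'm).
         induced_by c T F \<and> cmc_immersion F N (- h) \<and> toward_great_circle c T N))}"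
    (is "infinite ?H")
proof -
  define m where "m = n - 1"
  have mn: "m \<ge> 2" "n = Suc m" "CARD('m) = m" using assms by (auto simp: m_def)
  let ?S = "{\<beta> \<in> {0<..<1}. flower_period m \<beta> / (2 * pi) \<in> \<rat>}"
  have "m * flower_kappa m \<beta> \<in> ?H" if S: "\<beta> \<in> ?S" for \<beta>
  proof -
    obtain \<phi> where "flower m \<beta> \<phi>" using ex_flower[OF mn(1)] S by auto
    then interpret flower m \<beta> \<phi> .
    show ?thesis using closed_flower[OF _ mn(3)] S \<kappa>_pos m_pos unfolding mn(2) by simp
  qed
  then have "(\<lambda>\<beta>. m * flower_kappa m \<beta>) ` ?S \<subseteq> ?H" by blast
  moreover have "inj_on (\<lambda>\<beta>. m * flower_kappa m \<beta>) ?S"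
    using inj_on_flower_kappa[of m] mn(1) by (auto simp: inj_on_def)
  then have "infinite ((\<lambda>\<beta>. m * flower_kappa m \<beta>) ` ?S)"
    using infinite_rational_periods[OF mn(1)] finite_imageD by blast
  ultimately show ?thesis by (rule infinite_super)
qed

end
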